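(* Let $T$ be the $(4,d_1)$-semiregular tree with $d_1\geq 4$, and let $G\leq\mathrm{Aut}(T)^+$ be the group constructed in the context. Then $\underline{G}(x)\cong\mathrm{Alt}(4)$ for each $x\in V_0(T)$ and $\underline{G}(y)\cong\mathrm{Sym}(d_1)$ for each $y\in V_1(T)$, but there does not exist a legal coloring $i$ of $T$ such that $G\supseteq\mathrm{Alt}_{(i)}(T)^+$.
   Context: The $(4,d_1)$-semiregular tree $T$ (put $d_0=4$) is the tree with bipartition $V(T)=V_0(T)\sqcup V_1(T)$ such that every edge joins $V_0(T)$ to $V_1(T)$ and vertices in $V_t(T)$ have degree $d_t$. $\mathrm{Aut}(T)^+$ is the subgroup of $\mathrm{Aut}(T)$ preserving $V_0(T)$ and $V_1(T)$. $S(v,r)$, $B(v,r)$ denote the sphere and ball of radius $r$ around a vertex $v$. $\underline{G}(v)\leq\mathrm{Sym}(E(v))$ is the permutation group induced by the stabilizer of $v$ in $G$ on the set $E(v)$ of edges incident to $v$; $\cong$ means permutation isomorphic. A legal coloring $i$ of $T$ is a map on $V(T)$ given by $i_0\colon V_0(T)\to\{1,\dots,d_1\}$ and $i_1\colon V_1(T)\to\{1,\dots,d_0\}$ such that for each $v\in V_1(T)$ the restriction $i_0|_{S(v,1)}$ is a bijection onto $\{1,\dots,d_1\}$, and for each $v\in V_0(T)$ the restriction $i_1|_{S(v,1)}$ is a bijection onto $\{1,\dots,d_0\}$. Put $\sigma_{(i)}(g,v)=i|_{S(g(v),1)}\circ g\circ i|_{S(v,1)}^{-1}$ and $\mathrm{Alt}_{(i)}(T)^+:=\{g\in\mathrm{Aut}(T)^+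 : \sigma_{(i)}(g,v)\text{ is even for each }v\in V(T)\}$. Rooted trees. For $e\geq 3$ let $T_{4,e,2}$ be the rooted tree of depth $2$ whose root has $4$ children, each having $e-1$ children. A legal coloring $j$ of $T_{4,e,2}$ assigns to the root and to the vertices at distance $2$ from the root colors in $\{1,\dots,e\}$, and to the children of the root colors in $\{1,\dots,4\}$, such that $j$ restricted to $S(\text{root},1)$ is a bijection onto $\{1,\dots,4\}$ and, for each child $x$ of the root, $j$ restricted to $S(x,1)$ is a bijection onto $\{1,\dots,e\}$. For $g\in\mathrm{Aut}(T_{4,e,2})$ and $x$ not a leaf, $\sigma_{(j)}(g,x)=j|_{S(g(x),1)}\circ g\circ j|_{S(x,1)}^{-1}$. Construction of $G$. Let $\tilde T_0=T_{4,3,2}$ with root $v_0$. Fix a bijection $\psi$ from $(\mathbf{F}_3)^2\setminus\{(0,0)\}$ to the eight vertices of $\tilde T_0$ at distance $2$ from $v_0$, such that two such vertices $x,y$ have the same parent if and only if $\psi^{-1}(x)$ and $\psi^{-1}(y)$ are multiples of one another. Via $\psi$ the natural action of $\mathrm{SL}(2,\mathbf{F}_3)$ on $(\mathbf{F}_3)^2\setminus\{(0,0)\}$ induces an action on $\tilde T_0$; let $\tilde G_0\leq\mathrm{Aut}(\tilde T_0)$ be its image. Let $\tilde T=T_{4,d_1,2}$ with root $v$. Fix legal colorings $\tilde j$ of $\tilde T$ and $\tilde j_0$ of $\tilde T_0$ with $\tilde j_0(v_0)=\tilde j(v)$ and let $\alpha\colon B(v,1)\to B(v_0,1)$ be the bijection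 preserving the colorings (and sending $v$ to $v_0$). Define $f\colon\mathrm{Aut}(\tilde T)\to\mathrm{Aut}(\tilde T_0)$: $f(g)$ is the unique automorphism of $\tilde T_0$ such that $f(g)(\alpha(x))=\alpha(g(x))$ for each $x\in B(v,1)$ and $\sigma_{(\tilde j_0)}(f(g),\alpha(x))$ has the same parity as $\sigma_{(\tilde j)}(g,x)$ for each $x\in S(v,1)$. Let $\tilde G=f^{-1}(\tilde G_0)\leq\mathrm{Aut}(\tilde T)$. For each $x\in V_0(T)$ fix an isomorphism of rooted trees $J_x\colon B(x,2)\to\tilde T$ (sending $x$ to $v$), and for $g\in\mathrm{Aut}(T)^+$ put $\Sigma_{(J)}(g,x)=J_{g(x)}\circ g\circ J_x^{-1}\in\mathrm{Aut}(\tilde T)$. Then $$G:=\{g\in\mathrm{Aut}(T)^+ : \Sigma_{(J)}(g,x)\in\tilde G\text{ for each }x\in V_0(T)\}.$$ *)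

theory Defs
  imports
    "HOL-Analysis.Determinants"
    "HOL-Algebra.Sym_Groups"
    "HOL-Combinatorics.Orbits"
begin

section \<open>Graphs and trees\<close>

text \<open>
  A simple graph is a vertex set \<open>V\<close> with a symmetric irreflexive adjacency relation
  \<open>E \<subseteq> V \<times> V\<close>, so an undirected edge \<open>{x, y}\<close> occurs in \<open>E\<close> as both ordered pairs.
\<close>

definition simple_graph :: "'a set \<Rightarrow> 'a rel \<Rightarrow> bool" where
  "simple_graph V E \<longleftrightarrow> E \<subseteq> V \<times> V \<and> sym E \<and> irrefl E"

definition graph_connected :: "'a set \<Rightarrow> 'a rel \<Rightarrow> bool" where
  "graph_connected V E \<longleftrightarrow> (\<forall>x\<in>V. \<forall>y\<in>V. (x, y) \<in> E\<^sup>*)"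

definition is_cycle :: "'a rel \<Rightarrow> 'a list \<Rightarrow> bool" where
  "is_cycle E xs \<longleftrightarrow> length xs \<ge> 3 \<and> distinct xs \<and>
     successively (\<lambda>x y. (x, y) \<in> E) xs \<and> (last xs, hd xs) \<in> E"

definition is_tree :: "'a set \<Rightarrow> 'a rel \<Rightarrow> bool" where
  "is_tree V E \<longleftrightarrow> simple_graph V E \<and> V \<noteq> {} \<and> graph_connected V E \<and> (\<forall>xs. \<not> is_cycle E xs)"

definition gball :: "'a rel \<Rightarrow> 'a \<Rightarrow> nat \<Rightarrow> 'a set" where
  "gball E x r = {y. \<exists>m\<le>r. (x, y) \<in> E ^^ m}"

definition gsphere :: "'a rel \<Rightarrow> 'a \<Rightarrow> nat \<Rightarrow> 'a set" where
  "gsphere E x r = {y. (x, y) \<in> E ^^ r \<and> (\<forall>m<r. (x, y) \<notin> E ^^ m)}"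

text \<open>
  Automorphisms are total functions that are the identity outside the vertex set, so that
  equality of automorphisms is equality of functions.
\<close>

definition graph_aut :: "'a set \<Rightarrow> 'a rel \<Rightarrow> ('a \<Rightarrow> 'a) set" where
  "graph_aut V E = {g. g permutes V \<and> (\<forall>x\<in>V. \<forall>y\<in>V. (g x, g y) \<in> E \<longleftrightarrow> (x, y) \<in> E)}"

definition semiregular_tree ::
  "nat \<Rightarrow> nat \<Rightarrow> 'a set \<Rightarrow> 'a set \<Rightarrow> 'a rel \<Rightarrow> bool" where
  "semiregular_tree d0 d1 V0 V1 E \<longleftrightarrow>
     is_tree (V0 \<union> V1) E \<and> V0 \<inter> V1 = {} \<and>
     (\<forall>(x, y)\<in>E. x \<in> V0 \<and> y \<in> V1 \<or> x \<in> V1 \<and> y \<in> V0) \<and>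
     (\<forall>x\<in>V0. finite (E `` {x}) \<and> card (E `` {x}) = d0) \<and>
     (\<forall>x\<in>V1. finite (E `` {x}) \<and> card (E `` {x}) = d1)"

definition aut_plus :: "'a set \<Rightarrow> 'a set \<Rightarrow> 'a rel \<Rightarrow> ('a \<Rightarrow> 'a) set" where
  "aut_plus V0 V1 E = {g \<in> graph_aut (V0 \<union> V1) E. g ` V0 = V0 \<and> g ` V1 = V1}"


section \<open>Local actions and permutation isomorphism\<close>

definition incident_edges :: "'a rel \<Rightarrow> 'a \<Rightarrow> 'a set set" where
  "incident_edges E x = {{x, y} | y. (x, y) \<in> E}"

definition local_action ::
  "'a rel \<Rightarrow> ('a \<Rightarrow> 'a) set \<Rightarrow> 'a \<Rightarrow> ('a set \<Rightarrow> 'a set) set" where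
  "local_action E G x = {perm_restrict (\<lambda>e. g ` e) (incident_edges E x) | g. g \<in> G \<and> g x = x}"

text \<open>
  \<open>H\<close> and \<open>K\<close> are sets of permutations of \<open>X\<close> and \<open>Y\<close>; the condition says
  \<open>K = \<phi> H \<phi>\<^sup>-\<^sup>1\<close> inside the symmetric group of \<open>Y\<close>.
\<close>

definition perm_isomorphic ::
  "'a set \<Rightarrow> ('a \<Rightarrow> 'a) set \<Rightarrow> 'b set \<Rightarrow> ('b \<Rightarrow> 'b) set \<Rightarrow> bool" where
  "perm_isomorphic X H Y K \<longleftrightarrow>
     (\<exists>\<phi>. bij_betw \<phi> X Y \<and>
        K = {k. k permutes Y \<and> (\<exists>h\<in>H. \<forall>x\<in>X. k (\<phi> x) = \<phi> (h x))})"


section \<open>Legal colorings\<close>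

text \<open>
  The maps \<open>i\<^sub>0\<close> and \<open>i\<^sub>1\<close> are merged into one function \<open>i\<close>, with \<open>i\<^sub>0\<close> its restriction to
  \<open>V\<^sub>0\<close> and \<open>i\<^sub>1\<close> its restriction to \<open>V\<^sub>1\<close>.
\<close>

definition legal_coloring ::
  "nat \<Rightarrow> nat \<Rightarrow> 'a set \<Rightarrow> 'a set \<Rightarrow> 'a rel \<Rightarrow> ('a \<Rightarrow> nat) \<Rightarrow> bool" where
  "legal_coloring d0 d1 V0 V1 E i \<longleftrightarrow>
     i ` V0 \<subseteq> {1..d1} \<and> i ` V1 \<subseteq> {1..d0} \<and>
     (\<forall>v\<in>V1. bij_betw i (gsphere E v 1) {1..d1}) \<and>
     (\<forall>v\<in>V0. bij_betw i (gsphere E v 1) {1..d0})"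

text \<open>
  The local permutation \<open>\<sigma>(g, v)\<close> of the colors occurring around \<open>v\<close>, extended by the
  identity to all of \<open>nat\<close>.
\<close>

definition local_perm :: "'a rel \<Rightarrow> ('a \<Rightarrow> nat) \<Rightarrow> ('a \<Rightarrow> 'a) \<Rightarrow> 'a \<Rightarrow> nat \<Rightarrow> nat" where
  "local_perm E i g v =
     perm_restrict (i \<circ> g \<circ> inv_into (gsphere E v 1) i) (i ` gsphere E v 1)"

definition alt_plus ::
  "'a set \<Rightarrow> 'a set \<Rightarrow> 'a rel \<Rightarrow> ('a \<Rightarrow> nat) \<Rightarrow> ('a \<Rightarrow> 'a) set" where
  "alt_plus V0 V1 E i =
     {g \<in> aut_plus V0 V1 E. \<forall>v\<in>V0 \<union> V1. evenperm (local_perm E i g v)}"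


section \<open>The rooted trees of depth two\<close>

datatype rvertex = RRoot | RChild nat | RLeaf nat nat

text \<open>
  \<open>RLeaf a b\<close> is the \<open>b\<close>-th child of \<open>RChild a\<close>. In the rooted tree with parameters
  \<open>d\<close> and \<open>e\<close> the root has \<open>d\<close> children, each of which has \<open>e - 1\<close> children.
\<close>

definition rt_children :: "nat \<Rightarrow> rvertex set" where
  "rt_children d = {RChild a | a. a < d}"

definition rt_leaves :: "nat \<Rightarrow> nat \<Rightarrow> rvertex set" where
  "rt_leaves d e = {RLeaf a b | a b. a < d \<and> b < e - 1}"

definition rt_verts :: "nat \<Rightarrow> nat \<Rightarrow> rvertex set" where
  "rt_verts d e = {RRoot} \<union> rt_children d \<union> rt_leaves d e"

definition rt_down :: "nat \<Rightarrow> nat \<Rightarrow> rvertex rel" where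
  "rt_down d e = {(RRoot, RChild a) | a. a < d} \<union>
                 {(RChild a, RLeaf a b) | a b. a < d \<and> b < e - 1}"

definition rt_edges :: "nat \<Rightarrow> nat \<Rightarrow> rvertex rel" where
  "rt_edges d e = rt_down d e \<union> (rt_down d e)\<inverse>"

definition rt_aut :: "nat \<Rightarrow> nat \<Rightarrow> (rvertex \<Rightarrow> rvertex) set" where
  "rt_aut d e = {g \<in> graph_aut (rt_verts d e) (rt_edges d e). g RRoot = RRoot}"

definition rt_legal_coloring :: "nat \<Rightarrow> nat \<Rightarrow> (rvertex \<Rightarrow> nat) \<Rightarrow> bool" where
  "rt_legal_coloring d e j \<longleftrightarrow>
     j ` ({RRoot} \<union> rt_leaves d e) \<subseteq> {1..e} \<and> j ` rt_children d \<subseteq> {1..d} \<and>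
     bij_betw j (gsphere (rt_edges d e) RRoot 1) {1..d} \<and>
     (\<forall>x\<in>rt_children d. bij_betw j (gsphere (rt_edges d e) x 1) {1..e})"


section \<open>The construction of the group\<close>

text \<open>
  The numeral type \<open>3\<close> is the ring of integers modulo 3, i.e. the field with three elements.
\<close>

type_synonym F3_plane = "3 ^ 2"

definition SL2_F3 :: "(3 ^ 2 ^ 2) set" where
  "SL2_F3 = {A. det A = 1}"

definition admissible_labelling :: "(F3_plane \<Rightarrow> rvertex) \<Rightarrow> bool" where
  "admissible_labelling \<psi> \<longleftrightarrow>
     bij_betw \<psi> (UNIV - {0}) (rt_leaves 4 3) \<and>
     (\<forall>u\<in>UNIV - {0}. \<forall>w\<in>UNIV - {0}.
        (\<exists>a b b'. \<psi> u = RLeaf a b \<and> \<psi> w = RLeaf a b') \<longleftrightarrow>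
        (\<exists>c. w = c *s u) \<and> (\<exists>c. u = c *s w))"

definition G0_tilde :: "(F3_plane \<Rightarrow> rvertex) \<Rightarrow> (rvertex \<Rightarrow> rvertex) set" where
  "G0_tilde \<psi> = {g \<in> rt_aut 4 3. \<exists>A\<in>SL2_F3. \<forall>u\<in>UNIV - {0}. g (\<psi> u) = \<psi> (A *v u)}"

text \<open>
  \<open>\<alpha>\<close> identifies the ball of radius 1 around the root in the tree with parameters \<open>4, e\<close>
  with the one in the tree with parameters \<open>4, 3\<close>.
\<close>

definition color_matching ::
  "nat \<Rightarrow> (rvertex \<Rightarrow> nat) \<Rightarrow> (rvertex \<Rightarrow> nat) \<Rightarrow> (rvertex \<Rightarrow> rvertex) \<Rightarrow> bool" where
  "color_matching e j j0 \<alpha> \<longleftrightarrow>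
     bij_betw \<alpha> (gball (rt_edges 4 e) RRoot 1) (gball (rt_edges 4 3) RRoot 1) \<and>
     \<alpha> RRoot = RRoot \<and>
     (\<forall>x\<in>gball (rt_edges 4 e) RRoot 1. j0 (\<alpha> x) = j x)"

definition f_map ::
  "nat \<Rightarrow> (rvertex \<Rightarrow> nat) \<Rightarrow> (rvertex \<Rightarrow> nat) \<Rightarrow> (rvertex \<Rightarrow> rvertex) \<Rightarrow>
   (rvertex \<Rightarrow> rvertex) \<Rightarrow> rvertex \<Rightarrow> rvertex" where
  "f_map e j j0 \<alpha> g = (THE h. h \<in> rt_aut 4 3 \<and>
     (\<forall>x\<in>gball (rt_edges 4 e) RRoot 1. h (\<alpha> x) = \<alpha> (g x)) \<and>
     (\<forall>x\<in>gsphere (rt_edges 4 e) RRoot 1.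
        evenperm (local_perm (rt_edges 4 3) j0 h (\<alpha> x)) \<longleftrightarrow>
        evenperm (local_perm (rt_edges 4 e) j g x)))"

definition G_tilde ::
  "nat \<Rightarrow> (F3_plane \<Rightarrow> rvertex) \<Rightarrow> (rvertex \<Rightarrow> nat) \<Rightarrow> (rvertex \<Rightarrow> nat) \<Rightarrow>
   (rvertex \<Rightarrow> rvertex) \<Rightarrow> (rvertex \<Rightarrow> rvertex) set" where
  "G_tilde e \<psi> j j0 \<alpha> = {g \<in> rt_aut 4 e. f_map e j j0 \<alpha> g \<in> G0_tilde \<psi>}"

definition rooted_ball_iso ::
  "'a rel \<Rightarrow> nat \<Rightarrow> nat \<Rightarrow> 'a \<Rightarrow> ('a \<Rightarrow> rvertex) \<Rightarrow> bool" where
  "rooted_ball_iso E d e x \<theta> \<longleftrightarrow>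
     bij_betw \<theta> (gball E x 2) (rt_verts d e) \<and> \<theta> x = RRoot \<and>
     (\<forall>y\<in>gball E x 2. \<forall>z\<in>gball E x 2. (\<theta> y, \<theta> z) \<in> rt_edges d e \<longleftrightarrow> (y, z) \<in> E)"

definition local_aut ::
  "'a rel \<Rightarrow> nat \<Rightarrow> nat \<Rightarrow> ('a \<Rightarrow> 'a \<Rightarrow> rvertex) \<Rightarrow> ('a \<Rightarrow> 'a) \<Rightarrow> 'a \<Rightarrow> rvertex \<Rightarrow> rvertex" where
  "local_aut E d e J g x =
     perm_restrict (J (g x) \<circ> g \<circ> inv_into (gball E x 2) (J x)) (rt_verts d e)"

definition G_group ::
  "nat \<Rightarrow> 'a set \<Rightarrow> 'a set \<Rightarrow> 'a rel \<Rightarrow> (F3_plane \<Rightarrow> rvertex) \<Rightarrow>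
   (rvertex \<Rightarrow> nat) \<Rightarrow> (rvertex \<Rightarrow> nat) \<Rightarrow> (rvertex \<Rightarrow> rvertex) \<Rightarrow>
   ('a \<Rightarrow> 'a \<Rightarrow> rvertex) \<Rightarrow> ('a \<Rightarrow> 'a) set" where
  "G_group d1 V0 V1 E \<psi> j j0 \<alpha> J =
     {g \<in> aut_plus V0 V1 E. \<forall>x\<in>V0. local_aut E 4 d1 J g x \<in> G_tilde d1 \<psi> j j0 \<alpha>}"

end

(* An element of the group acts on the star of a vertex of type 0 as an element of SL(2, F_3) acts on
   the four lines of the plane, that is, evenly. Conversely, SL(2, F_3) is transitive on nonzero
   vectors, so an allowed germ on the star of a vertex of type 1 always extends to an allowed germ
   on the 2-ball around a neighbour; since T is a tree, germs extend to elements of G.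

   Suppose that G contains the group Alt of a legal coloring i. Let p = (1 2)(3 4). Recoloring the
   vertices of type 1 by p gives another legal coloring, so there is an automorphism g fixing a vertex
   x of type 0 that carries one coloring to the other; its local permutations are p and 1, so it
   lies in Alt, and g^2 = 1. Hence f sends g to an involution of SL(2, F_3). The only one is -1,
   which fixes every line, whereas g moves the neighbours of x. *)

theory Submission
  imports Defs
begin

section \<open>The action of \<open>SL(2, 3)\<close> on lines\<close>

text \<open>The obstruction is an extension that does not split. \<open>SL(2, F_3)\<close> maps onto
  Alt(4), its group of permutations of the lines, with kernel {1, -1}; a product of two disjoint
  transpositions lifts only to matrices of trace 0, whose square is -1. So an element of G acting by
  such a product on the star of a vertex of type 0 has a nontrivial square on the ball of radius 2.

  Apart from the permutation of the four children, the map f retains one parity for each child. In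
  the tree with eight leaves, the image of a child and the parity there determine the map on its two
  leaves, so f is well defined. In the tree with d1 - 1 leaves below each child, a transposition of
  two leaves changes a parity and nothing else that f sees, so every pattern of parities occurs.
  Extending a germ from one star therefore asks for an element of \<open>SL(2, F_3)\<close> with one
  prescribed line, its image and one parity. That is the same as prescribing the image of one
  vector, since the image of its negative is then forced; this is why transitivity on nonzero
  vectors, and not merely on lines, is the property that counts.\<close>

lemma F3_exhaust: "(x :: 3) = 0 \<or> x = 1 \<or> x = -1"
proof -
  have "(2 :: 3) = -1" and "(3 :: 3) = 0"
    by simp_all
  then show ?thesis
    using UNIV_3 by (metis UNIV_I insert_iff singletonD)
qed

text \<open>A nonzero scalar is its own inverse, so the explicit matrices below multiply by a
  determinant where one would otherwise divide by it.\<close>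

lemma F3_square: "(x :: 3) \<noteq> 0 \<Longrightarrow> x * x = 1"
  using F3_exhaust[of x] by auto

lemma F3_no_zero_div: "(x :: 3) \<noteq> 0 \<Longrightarrow> y \<noteq> 0 \<Longrightarrow> x * y \<noteq> 0"
  using F3_exhaust[of x] by auto

lemma F3_two: "(1 :: 3) + 1 = -1" "(-1 :: 3) + -1 = 1" "(-1 :: 3) - 1 = 1" "(-1 :: 3) \<noteq> 1" "(1 :: 3) \<noteq> -1"
  by simp_all

lemma F3_proportional:
  fixes a b c d :: 3
  assumes "a * d - b * c = 0" "a \<noteq> 0 \<or> b \<noteq> 0" "c \<noteq> 0 \<or> d \<noteq> 0"
  shows "c = a \<and> d = b \<or> c = - a \<and> d = - b"
  using F3_exhaust[of a] F3_exhaust[of b] F3_exhaust[of c] F3_exhaust[of d] assms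
  by (elim disjE) (simp_all add: F3_two)

text \<open>The determinant with columns \<open>u\<close> and \<open>w\<close>, that is, the
  symplectic form preserved by \<open>SL2_F3\<close>. On nonzero vectors it vanishes exactly when
  they span the same line, which turns statements about lines into equations in the field.\<close>

definition cross2 :: "F3_plane \<Rightarrow> F3_plane \<Rightarrow> 3" where
  "cross2 u w = u $ 1 * w $ 2 - u $ 2 * w $ 1"

lemma F3_plane_eq_iff: "(u :: F3_plane) = w \<longleftrightarrow> u $ 1 = w $ 1 \<and> u $ 2 = w $ 2"
  by (simp add: vec_eq_iff forall_2)

lemma mult_vec_F3:
  fixes A :: "3 ^ 2 ^ 2"
  shows "(A *v u) $ i = A $ i $ 1 * u $ 1 + A $ i $ 2 * u $ 2"
  by (simp add: matrix_vector_mult_def sum_2)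

lemma mult_vec_F3_minus: "(A :: 3 ^ 2 ^ 2) *v (- u) = - (A *v u)"
  by (simp add: F3_plane_eq_iff mult_vec_F3)

lemma cross2_eq_0:
  assumes "cross2 u w = 0" "u \<noteq> 0" "w \<noteq> 0"
  shows "w = u \<or> w = - u"
  using F3_proportional[of "u $ 1" "w $ 2" "u $ 2" "w $ 1"] assms
  by (auto simp: cross2_def F3_plane_eq_iff)

lemma cross2_mult: "cross2 (A *v u) (A *v w) = det A * cross2 u w"
  by (simp add: cross2_def mult_vec_F3 det_2 algebra_simps)

lemma cross2_nonzero_ex:
  assumes "u \<noteq> 0"
  shows "\<exists>w. cross2 u w \<noteq> 0"
\<comment> \<open>At the quarter turn of \<open>u\<close> the form takes the value
  \<open>u $ 1 * u $ 1 + u $ 2 * u $ 2\<close>, and a sum of two squares vanishes only trivially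
  because -1 is not a square modulo 3.\<close>
proof (rule exI[of _ "vector [- u $ 2, u $ 1]"])
  show "cross2 u (vector [- u $ 2, u $ 1]) \<noteq> 0"
    using assms F3_square[of "u $ 1"] F3_square[of "u $ 2"]
    by (cases "u $ 1 = 0"; cases "u $ 2 = 0") (auto simp: cross2_def F3_plane_eq_iff vector_2)
qed

lemma SL2_F3_nonzero:
  assumes "A \<in> SL2_F3" "u \<noteq> 0"
  shows "A *v u \<noteq> 0"
proof
  assume "A *v u = 0"
  moreover obtain w where "cross2 u w \<noteq> 0"
    using cross2_nonzero_ex assms(2) by blast
  ultimately show False
    using cross2_mult[of A u w] assms(1) by (simp add: SL2_F3_def cross2_def)
qed

lemma F3_plane_minus_neq: "(u :: F3_plane) \<noteq> 0 \<Longrightarrow> - u \<noteq> u"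
  using F3_exhaust[of "u $ 1"] F3_exhaust[of "u $ 2"] by (auto simp: F3_plane_eq_iff)

text \<open>The linear map taking \<open>u\<close> to \<open>w\<close> and \<open>u'\<close> to
  \<open>w'\<close> has determinant 1 or -1, and a change of sign at \<open>w'\<close> repairs the
  second case. On lines this is double transitivity.\<close>

lemma SL2_F3_extend:
  assumes "cross2 u u' \<noteq> 0" "cross2 w w' \<noteq> 0"
  shows "\<exists>A\<in>SL2_F3. A *v u = w \<and> (A *v u' = w' \<or> A *v u' = - w')"
proof -
  define \<delta> where "\<delta> = cross2 u u'"
  define s where "s = \<delta> * cross2 w w'"
  \<comment> \<open>Cramer's rule for the map taking \<open>u\<close> to \<open>w\<close> and
    \<open>u'\<close> to \<open>s *s w'\<close>, with \<open>\<delta>\<close> in the place of its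
    own inverse; \<open>s\<close> is the sign that makes the determinant 1.\<close>
  define A :: "3 ^ 2 ^ 2" where
    "A = (\<chi> i k. if k = 1 then \<delta> * (u' $ 2 * w $ i - u $ 2 * s * w' $ i)
                 else \<delta> * (u $ 1 * s * w' $ i - u' $ 1 * w $ i))"
  have \<delta>: "\<delta> * \<delta> = 1" and \<epsilon>: "cross2 w w' * cross2 w w' = 1"
    using assms F3_square by (auto simp: \<delta>_def)
  have 1: "A *v u = (\<delta> * cross2 u u') *s w"
    by (simp add: F3_plane_eq_iff mult_vec_F3 A_def cross2_def algebra_simps)
  have 2: "A *v u' = (\<delta> * cross2 u u' * s) *s w'"
    by (simp add: F3_plane_eq_iff mult_vec_F3 A_def cross2_def algebra_simps)
  have "det A = \<delta> * \<delta> * cross2 u u' * s * cross2 w w'"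
    by (simp add: det_2 A_def cross2_def algebra_simps)
  also have "\<dots> = (\<delta> * \<delta>) * (\<delta> * \<delta>) * (cross2 w w' * cross2 w w')"
    unfolding s_def \<delta>_def[symmetric] by (simp add: ac_simps)
  finally have "det A = 1"
    using \<delta> \<epsilon> by simp
  moreover have "A *v u = w"
    using 1 \<delta> by (simp add: \<delta>_def[symmetric])
  moreover have "A *v u' = s *s w'"
    using 2 \<delta> by (simp add: \<delta>_def[symmetric])
  moreover have "s = 1 \<or> s = -1"
    using F3_exhaust[of s] F3_no_zero_div[OF assms] by (simp add: s_def \<delta>_def)
  moreover have "(-1) *s w' = - w'"
    by (simp add: F3_plane_eq_iff)
  ultimately show ?thesis
    by (intro bexI[of _ A]) (auto simp: SL2_F3_def)
qed

lemma SL2_F3_transitive: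
  assumes "u \<noteq> 0" "w \<noteq> 0"
  shows "\<exists>A\<in>SL2_F3. A *v u = w"
  using cross2_nonzero_ex[OF assms(1)] cross2_nonzero_ex[OF assms(2)] SL2_F3_extend by meson

lemma SL2_F3_Cayley_Hamilton:
  assumes "A \<in> SL2_F3"
  shows "A *v (A *v u) = trace A *s (A *v u) - u"
proof -
  have "det A *s u = u"
    using assms by (simp add: SL2_F3_def)
  moreover have "A *v (A *v u) = trace A *s (A *v u) - det A *s u"
    by (simp add: F3_plane_eq_iff mult_vec_F3 trace_def sum_2 det_2 algebra_simps)
  ultimately show ?thesis
    by simp
qed

text \<open>Cayley--Hamilton gives \<open>trace A *s (A *v u) = 2u = -u\<close>. Hence the trace is
  not 0, and \<open>A *v u\<close> is a multiple of \<open>u\<close>.\<close>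

lemma SL2_F3_involution:
  assumes "A \<in> SL2_F3" and inv: "\<And>u. u \<noteq> 0 \<Longrightarrow> A *v (A *v u) = u" and "u \<noteq> 0"
  shows "A *v u = u \<or> A *v u = - u"
proof -
  have "trace A *s (A *v u) = - u"
    using SL2_F3_Cayley_Hamilton[OF assms(1), of u] inv[OF \<open>u \<noteq> 0\<close>]
      F3_exhaust[of "u $ 1"] F3_exhaust[of "u $ 2"]
    by (auto simp: F3_plane_eq_iff algebra_simps)
  moreover have "trace A = 0 \<or> trace A = 1 \<or> trace A = -1"
    by (rule F3_exhaust)
  ultimately show ?thesis
    using \<open>u \<noteq> 0\<close> by (auto simp: F3_plane_eq_iff)
qed

section \<open>Parity of permutations of four points\<close>

text \<open>Such a permutation is a product of two disjoint transpositions: it exchanges 1 with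
  \<open>a = k 1\<close>, and then must exchange the two remaining points \<open>b\<close> and
  \<open>c\<close>.\<close>

lemma evenperm_involution_4:
  fixes k :: "nat \<Rightarrow> nat"
  assumes k: "k permutes {1..4}"
    and inv: "\<And>x. x \<in> {1..4} \<Longrightarrow> k (k x) = x" and nofix: "\<And>x. x \<in> {1..4} \<Longrightarrow> k x \<noteq> x"
  shows "evenperm k"
proof -
  have out: "k x = x" if "x \<notin> {1..4}" for x
    using k that by (rule permutes_not_in)
  have "\<exists>a b c. {1..4} = {1, a, b, c} \<and> distinct [1, a, b, c] \<and> k 1 = a"
  proof -
    have "k 1 \<in> {1..4}" using permutes_in_image[OF k, of 1] by simp
    then have "k 1 \<in> {2, 3, 4}" using nofix[of 1] by force
    then consider "k 1 = 2" | "k 1 = 3" | "k 1 = 4" by blast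
    then show ?thesis
    proof cases
      case 1 then show ?thesis by (intro exI[of _ 2] exI[of _ 3] exI[of _ 4]) auto
    next
      case 2 then show ?thesis by (intro exI[of _ 3] exI[of _ 2] exI[of _ 4]) auto
    next
      case 3 then show ?thesis by (intro exI[of _ 4] exI[of _ 2] exI[of _ 3]) auto
    qed
  qed
  then obtain a b c where abc: "{1..4} = {1, a, b, c}" "distinct [1, a, b, c]" "k 1 = a"
    by blast
  have "k a = 1" using inv[of 1] abc by simp
  have "k b \<in> {1, a, b, c}" using k abc(1) by (metis insertCI permutes_in_image)
  moreover have "k b \<noteq> b" using nofix abc(1) by blast
  moreover have "k b \<noteq> 1" "k b \<noteq> a"
    using k abc \<open>k a = 1\<close> by (metis distinct_length_2_or_more permutes_def)+
  ultimately have "k b = c" by blast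
  moreover have "k (k b) = b" using inv abc(1) by blast
  ultimately have "k c = b" by simp
  have "k = Transposition.transpose 1 a \<circ> Transposition.transpose b c"
  proof
    fix x show "k x = (Transposition.transpose 1 a \<circ> Transposition.transpose b c) x"
      using abc \<open>k a = 1\<close> \<open>k b = c\<close> \<open>k c = b\<close> out[of x]
      by (cases "x \<in> {1, a, b, c}") (auto simp: transpose_def)
  qed
  then show ?thesis
    using abc(2) by (simp add: evenperm_comp evenperm_swap permutation_swap_id)
qed

text \<open>The only other permutation of four points that fixes 1 and 2 is the transposition of 3
  and 4, which is odd.\<close>

lemma evenperm_fixing_two:
  fixes m :: "nat \<Rightarrow> nat"
  assumes m: "m permutes {1..4}" "evenperm m" "m 1 = 1" "m 2 = 2"
  shows "m = id"
proof -
  have out: "m x = x" if "x \<notin> {1..4}" for x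
    using m(1) that by (rule permutes_not_in)
  have inj: "m x = m y \<longleftrightarrow> x = y" for x y
    using permutes_inj[OF m(1)] by (auto simp: inj_def)
  have set: "x \<in> {1..4} \<longleftrightarrow> x = 1 \<or> x = 2 \<or> x = 3 \<or> x = 4" for x :: nat
    by auto
  have "m 3 \<in> {1..4}" "m 4 \<in> {1..4}"
    using permutes_in_image[OF m(1)] by simp_all
  then have "m 3 = 3 \<and> m 4 = 4 \<or> m 3 = 4 \<and> m 4 = 3"
    unfolding set using inj[of 3 4] inj[of 3 1] inj[of 3 2] inj[of 4 1] inj[of 4 2] m(3,4) by auto
  moreover have "m \<noteq> Transposition.transpose 3 4"
    using m(2) by (auto simp: evenperm_swap)
  moreover have "m = Transposition.transpose 3 4" if "m 3 = 4" "m 4 = 3"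
  proof
    fix x show "m x = Transposition.transpose 3 4 x"
      using that m(3,4) out[of x] set[of x] by (cases "x \<in> {1..4}") (auto simp: transpose_def)
  qed
  ultimately have "m 3 = 3" "m 4 = 4" by auto
  then show ?thesis
    using m(3,4) out set by (metis eq_id_iff)
qed

section \<open>The permutations of the four lines\<close>

text \<open>A numbering of the projective line over F_3, expressed on nonzero representatives so
  that no quotient is formed. It starts at 1 to match the permutation groups
  \<open>alt_group\<close> and \<open>sym_group\<close>.\<close>

definition line_numbering :: "(F3_plane \<Rightarrow> nat) \<Rightarrow> bool" where
  "line_numbering \<beta> \<longleftrightarrow> \<beta> ` (UNIV - {0}) = {1..4} \<and>
     (\<forall>u w. u \<noteq> 0 \<longrightarrow> w \<noteq> 0 \<longrightarrow> (\<beta> u = \<beta> w \<longleftrightarrow> w = u \<or> w = - u))"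

lemma line_numbering_surj:
  assumes "line_numbering \<beta>" "x \<in> {1..4}"
  shows "\<exists>u. u \<noteq> 0 \<and> \<beta> u = x"
proof -
  have "x \<in> \<beta> ` (UNIV - {0})"
    using assms by (simp only: line_numbering_def)
  then show ?thesis by blast
qed

lemma line_numbering_eq_iff:
  "line_numbering \<beta> \<Longrightarrow> u \<noteq> 0 \<Longrightarrow> w \<noteq> 0 \<Longrightarrow> \<beta> u = \<beta> w \<longleftrightarrow> w = u \<or> w = - u"
  unfolding line_numbering_def by blast

lemma line_numbering_in: "line_numbering \<beta> \<Longrightarrow> u \<noteq> 0 \<Longrightarrow> \<beta> u \<in> {1..4}"
  unfolding line_numbering_def by blast

text \<open>By Cayley--Hamilton, an element of trace 0 acts on the lines as an involution without fixed
  points, and the cube of any other element is \<open>1\<close> or \<open>-1\<close>, so it acts trivially.\<close>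

lemma SL2_F3_lines_even:
  assumes \<beta>: "line_numbering \<beta>" and A: "A \<in> SL2_F3" and k: "k permutes {1..4}"
    and kA: "\<And>u. u \<noteq> 0 \<Longrightarrow> k (\<beta> u) = \<beta> (A *v u)"
  shows "evenperm k"
proof -
  note surj = line_numbering_surj[OF \<beta>] and eq = line_numbering_eq_iff[OF \<beta>]
  note nz = SL2_F3_nonzero[OF A]
  note CH = SL2_F3_Cayley_Hamilton[OF A]
  show ?thesis
  proof (cases "trace A = 0")
    case True
    then have sq: "A *v (A *v u) = - u" for u
      using CH[of u] by (simp add: F3_plane_eq_iff)
    show ?thesis
    proof (rule evenperm_involution_4[OF k])
      fix x assume "x \<in> {1..4::nat}"
      then obtain u where u: "u \<noteq> 0" "\<beta> u = x" using surj by blast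
      show "k (k x) = x"
        using kA[OF u(1)] kA[OF nz[OF u(1)]] eq[of u "- u"] u sq by simp
      show "k x \<noteq> x"
      proof
        assume "k x = x"
        then have "A *v u = u \<or> A *v u = - u"
          using kA[OF u(1)] u eq[OF u(1) nz[OF u(1)]] by auto
        then have "A *v (A *v u) = u"
          by (auto simp: mult_vec_F3_minus)
        then show False
          using sq F3_plane_minus_neq[OF u(1)] by simp
      qed
    qed
  next
    case False
    then have t: "trace A = 1 \<or> trace A = -1"
      using F3_exhaust by blast
    have cube: "A *v (A *v (A *v u)) = u \<or> A *v (A *v (A *v u)) = - u" for u
    proof -
      have "A *v (A *v (A *v u)) = trace A *s (trace A *s (A *v u) - u) - A *v u"
        unfolding CH[of "A *v u"] unfolding CH[of u] ..
      then show ?thesis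
        using t by (elim disjE) (simp_all add: F3_plane_eq_iff)
    qed
    have "(k \<circ> (k \<circ> k)) x = x" for x
    proof (cases "x \<in> {1..4}")
      case True
      then obtain u where u: "u \<noteq> 0" "\<beta> u = x" using surj by blast
      have "(k \<circ> (k \<circ> k)) x = \<beta> (A *v (A *v (A *v u)))"
        using u by (simp add: nz flip: kA)
      also have "\<dots> = \<beta> u"
        using cube[of u] eq[of u "- u"] u(1) by auto
      finally show ?thesis
        using u(2) by simp
    qed (simp add: permutes_not_in[OF k])
    then have "k \<circ> (k \<circ> k) = id" by (simp add: fun_eq_iff)
    moreover have "permutation k"
      using k by (auto simp: permutation_permutes)
    \<comment> \<open>A permutation has the same parity as its cube, and the cube is the
      identity.\<close>
    ultimately show ?thesis
      using evenperm_comp[of k "k \<circ> k"] evenperm_comp[of k k] permutation_compose[of k k] by simp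
  qed
qed

text \<open>The function \<open>r\<close> picks a representative of each line. The choice between
  \<open>u\<close> and \<open>- u\<close> is harmless because \<open>A\<close> commutes with the
  sign, and distinct lines stay distinct because \<open>A\<close> preserves
  \<open>cross2\<close>.\<close>

lemma SL2_F3_induces_line_perm:
  assumes \<beta>: "line_numbering \<beta>" and A: "A \<in> SL2_F3"
  shows "\<exists>k. k permutes {1..4} \<and> (\<forall>u. u \<noteq> 0 \<longrightarrow> k (\<beta> u) = \<beta> (A *v u))"
proof -
  note eq = line_numbering_eq_iff[OF \<beta>] and in4 = line_numbering_in[OF \<beta>]
  note nz = SL2_F3_nonzero[OF A]
  define r where "r x = (SOME u. u \<noteq> 0 \<and> \<beta> u = x)" for x
  have r: "r x \<noteq> 0 \<and> \<beta> (r x) = x" if "x \<in> {1..4}" for x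
    unfolding r_def by (rule someI_ex) (rule line_numbering_surj[OF \<beta> that])
  define k where "k x = (if x \<in> {1..4} then \<beta> (A *v r x) else x)" for x
  have k\<beta>: "k (\<beta> u) = \<beta> (A *v u)" if "u \<noteq> 0" for u
  proof -
    have "r (\<beta> u) = u \<or> r (\<beta> u) = - u"
      using r[OF in4[OF that]] eq[OF that, of "r (\<beta> u)"] by simp
    then show ?thesis
      using in4[OF that] eq[OF nz[OF that] nz[of "- u"]] that
      by (elim disjE) (simp_all add: k_def mult_vec_F3_minus)
  qed
  have "inj_on k {1..4}"
  proof (rule inj_onI)
    fix x y assume xy: "x \<in> {1..4}" "y \<in> {1..4}" "k x = k y"
    then have "\<beta> (A *v r x) = \<beta> (A *v r y)"
      by (simp add: k_def)
    then have "A *v r y = A *v r x \<or> A *v r y = - (A *v r x)"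
      using eq[OF nz nz] r xy(1,2) by blast
    then have "cross2 (r x) (r y) = 0"
      using cross2_mult[of A "r x" "r y"] A by (auto simp: SL2_F3_def cross2_def)
    then show "x = y"
      using cross2_eq_0[of "r x" "r y"] eq[of "r x" "r y"] r[OF xy(1)] r[OF xy(2)] by simp
  qed
  moreover have "k ` {1..4} \<subseteq> {1..4}"
    using in4 nz r by (auto simp: k_def)
  ultimately have "bij_betw k {1..4} {1..4}"
    by (simp add: bij_betw_def endo_inj_surj del: atLeastAtMost_iff)
  then have "k permutes {1..4}"
    by (rule bij_imp_permutes) (auto simp: k_def)
  then show ?thesis
    using k\<beta> by blast
qed

text \<open>An even permutation of four points is determined by two of its values.\<close>

lemma SL2_F3_realizes_even:
  assumes \<beta>: "line_numbering \<beta>" and k: "k permutes {1..4}" "evenperm k"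
  shows "\<exists>A\<in>SL2_F3. \<forall>u. u \<noteq> 0 \<longrightarrow> k (\<beta> u) = \<beta> (A *v u)"
proof -
  note surj = line_numbering_surj[OF \<beta>] and eq = line_numbering_eq_iff[OF \<beta>]
  obtain u u' where u: "u \<noteq> 0" "\<beta> u = 1" "u' \<noteq> 0" "\<beta> u' = 2"
    using surj[of 1] surj[of 2] by auto
  have k12: "k 1 \<in> {1..4}" "k 2 \<in> {1..4}" "k 1 \<noteq> k 2"
    using permutes_in_image[OF k(1)] inj_eq[OF permutes_inj[OF k(1)], of 1 2] by simp_all
  obtain w w' where w: "w \<noteq> 0" "\<beta> w = k 1" "w' \<noteq> 0" "\<beta> w' = k 2"
    using surj[OF k12(1)] surj[OF k12(2)] by auto
  have "cross2 u u' \<noteq> 0" "cross2 w w' \<noteq> 0"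
    using cross2_eq_0[of u u'] cross2_eq_0[of w w'] eq[of u u'] eq[of w w'] u w k12(3) by auto
  then obtain A where A: "A \<in> SL2_F3" "A *v u = w" "A *v u' = w' \<or> A *v u' = - w'"
    using SL2_F3_extend by blast
  obtain k' where k': "k' permutes {1..4}" "\<And>u. u \<noteq> 0 \<Longrightarrow> k' (\<beta> u) = \<beta> (A *v u)"
    using SL2_F3_induces_line_perm[OF \<beta> A(1)] by blast
  have "evenperm k'"
    using SL2_F3_lines_even[OF \<beta> A(1) k'] .
  have "k' 1 = k 1"
    using k'(2)[OF u(1)] u A w by simp
  \<comment> \<open>The sign left open in the value of \<open>A *v u'\<close> is invisible on
    lines.\<close>
  have "k' 2 = k 2"
    using k'(2)[OF u(3)] u A(3) w eq[of w' "- w'"] by auto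
  have perm: "permutation k" "permutation k'"
    using k(1) k'(1) by (auto simp: permutation_permutes)
  have "inv' k' \<circ> k = id"
  proof (rule evenperm_fixing_two)
    show "inv' k' \<circ> k permutes {1..4}"
      using k(1) k'(1) by (simp add: permutes_compose permutes_inv)
    show "evenperm (inv' k' \<circ> k)"
      using perm k(2) \<open>evenperm k'\<close> by (simp add: evenperm_comp evenperm_inv permutation_inverse)
    show "(inv' k' \<circ> k) 1 = 1" "(inv' k' \<circ> k) 2 = 2"
      by (simp_all add: permutes_inv_eq[OF k'(1)] \<open>k' 1 = k 1\<close> \<open>k' 2 = k 2\<close> flip: One_nat_def)
  qed
  then have "k = k'"
    by (simp add: fun_eq_iff permutes_inv_eq[OF k'(1)])
  then show ?thesis
    using A(1) k'(2) by blast
qed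

section \<open>Trees\<close>

lemma is_treeD:
  assumes "is_tree V E"
  shows is_tree_edge_verts: "(a, b) \<in> E \<Longrightarrow> a \<in> V \<and> b \<in> V"
    and is_tree_sym: "(a, b) \<in> E \<Longrightarrow> (b, a) \<in> E"
    and is_tree_irrefl: "(a, a) \<notin> E"
    and is_tree_connected: "a \<in> V \<Longrightarrow> b \<in> V \<Longrightarrow> (a, b) \<in> E\<^sup>*"
    and is_tree_acyclic: "\<not> is_cycle E xs"
  using assms unfolding is_tree_def simple_graph_def graph_connected_def sym_def irrefl_def by blast+

text \<open>The path is kept free of repetitions as it grows: if the next vertex already occurs on
  it, the path is cut off at that occurrence.\<close>

lemma rtrancl_distinct_path:
  assumes "(a, b) \<in> R\<^sup>*"
  shows "\<exists>xs. xs \<noteq> [] \<and> distinct xs \<and> hd xs = a \<and> last xs = b \<and> successively (\<lambda>x y. (x, y) \<in> R) xs"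
  using assms
proof (induction rule: rtrancl_induct)
  case base
  show ?case by (rule exI[of _ "[a]"]) simp
next
  case (step b c)
  then obtain xs where xs: "xs \<noteq> []" "distinct xs" "hd xs = a" "last xs = b"
    "successively (\<lambda>x y. (x, y) \<in> R) xs" by blast
  show ?case
  proof (cases "c \<in> set xs")
    case True
    then obtain ys zs where "xs = ys @ c # zs"
      by (meson split_list)
    then have "xs = (ys @ [c]) @ zs" by simp
    then show ?thesis
      using xs by (intro exI[of _ "ys @ [c]"]) (auto simp: successively_append_iff hd_append)
  next
    case False
    then show ?thesis
      using xs step.hyps(2)
      by (intro exI[of _ "xs @ [c]"]) (auto simp: successively_append_iff)
  qed
qed

text \<open>A path from \<open>a\<close> to \<open>b\<close> that avoids the edge between them would
  close up with this edge to a cycle.\<close>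

lemma is_tree_bridge:
  assumes tree: "is_tree V E" and ab: "(a, b) \<in> E"
  shows "(a, b) \<notin> (E - {(a, b), (b, a)})\<^sup>*"
proof
  assume "(a, b) \<in> (E - {(a, b), (b, a)})\<^sup>*"
  from rtrancl_distinct_path[OF this] obtain xs where xs: "xs \<noteq> []" "distinct xs" "hd xs = a"
    "last xs = b" "successively (\<lambda>x y. (x, y) \<in> E - {(a, b), (b, a)}) xs"
    by blast
  have "a \<noteq> b" using is_tree_irrefl[OF tree] ab by blast
  obtain x ys where 1: "xs = x # ys" using xs(1) by (cases xs) auto
  with xs \<open>a \<noteq> b\<close> have "ys \<noteq> []" by auto
  then obtain y zs where 2: "ys = y # zs" by (cases ys) auto
  \<comment> \<open>A path with only two vertices would consist of the removed edge itself.\<close>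
  have "zs \<noteq> []" using xs 1 2 by auto
  then have "length xs \<ge> 3" using 1 2 by (cases zs) auto
  moreover have "successively (\<lambda>x y. (x, y) \<in> E) xs"
    using xs(5) by (rule successively_mono) auto
  ultimately have "is_cycle E xs"
    using xs is_tree_sym[OF tree ab] by (simp add: is_cycle_def)
  then show False using is_tree_acyclic[OF tree] by blast
qed

section \<open>Distance from a root and outward recursion\<close>

definition depth :: "'a rel \<Rightarrow> 'a \<Rightarrow> 'a \<Rightarrow> nat" where
  "depth E r v = (LEAST n. (r, v) \<in> E ^^ n)"

context
  fixes V :: "'a set" and E :: "'a rel" and r :: 'a
  assumes tree: "is_tree V E" and r: "r \<in> V"
begin

lemma depth_path: "v \<in> V \<Longrightarrow> (r, v) \<in> E ^^ depth E r v"
  unfolding depth_def using is_tree_connected[OF tree r] by (metis LeastI_ex rtrancl_power)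

lemma depth_le: "(r, v) \<in> E ^^ n \<Longrightarrow> depth E r v \<le> n"
  unfolding depth_def by (rule Least_le)

lemma depth_root: "depth E r r = 0"
  using depth_le[of r 0] by simp

lemma depth_eq_0: "v \<in> V \<Longrightarrow> depth E r v = 0 \<Longrightarrow> v = r"
  using depth_path[of v] by simp

lemma depth_edge: "(v, w) \<in> E \<Longrightarrow> depth E r w \<le> Suc (depth E r v)"
  using depth_path[of v] is_tree_edge_verts[OF tree, of v w] by (intro depth_le) auto

lemma depth_pred:
  assumes "v \<in> V" "depth E r v = Suc n"
  shows "\<exists>u. (u, v) \<in> E \<and> depth E r u = n"
proof -
  obtain u where u: "(r, u) \<in> E ^^ n" "(u, v) \<in> E"
    using depth_path[OF assms(1)] assms(2) by auto
  then have "depth E r u = n"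
    using depth_le[OF u(1)] depth_edge[OF u(2)] assms(2) by simp
  with u(2) show ?thesis by blast
qed

text \<open>On a shortest path from the root to \<open>u\<close>, every vertex before
  \<open>u\<close> has depth strictly less than that of \<open>v\<close>, so the path never meets
  \<open>v\<close>.\<close>

lemma root_reaches_below:
  assumes "u \<in> V" "u \<noteq> v" "depth E r u \<le> depth E r v"
  shows "(r, u) \<in> {(x, y) \<in> E. x \<noteq> v \<and> y \<noteq> v}\<^sup>*"
  using assms
proof (induction "depth E r u" arbitrary: u)
  case 0
  then have "u = r" using depth_eq_0[of u] by simp
  then show ?case by simp
next
  case (Suc n)
  then obtain w where w: "(w, u) \<in> E" "depth E r w = n"
    using depth_pred[of u n] by auto
  then have "w \<noteq> v" "w \<in> V"
    using Suc is_tree_edge_verts[OF tree] by auto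
  then have "(r, w) \<in> {(x, y) \<in> E. x \<noteq> v \<and> y \<noteq> v}\<^sup>*"
    using Suc w by simp
  moreover have "(w, u) \<in> {(x, y) \<in> E. x \<noteq> v \<and> y \<noteq> v}"
    using w \<open>w \<noteq> v\<close> Suc.prems by simp
  ultimately show ?case by (rule rtrancl_into_rtrancl)
qed

lemma lower_neighbour_unique:
  assumes "(u, v) \<in> E" "(w, v) \<in> E" "depth E r u \<le> depth E r v" "depth E r w \<le> depth E r v"
  shows "u = w"
proof (rule ccontr)
  assume "u \<noteq> w"
  have neq: "u \<noteq> v" "w \<noteq> v" and inV: "u \<in> V" "w \<in> V"
    using assms is_tree_irrefl[OF tree] is_tree_edge_verts[OF tree] by blast+
  let ?R = "E - {(u, v), (v, u)}"
  have sub: "{(x, y) \<in> E. x \<noteq> v \<and> y \<noteq> v} \<subseteq> ?R"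
    by auto
  have symR: "sym ?R"
    using is_tree_sym[OF tree] by (auto intro!: symI)
  have "(r, u) \<in> ?R\<^sup>*" "(r, w) \<in> ?R\<^sup>*"
    using root_reaches_below[OF inV(1) neq(1) assms(3)] root_reaches_below[OF inV(2) neq(2) assms(4)]
      rtrancl_mono[OF sub] by blast+
  then have "(u, w) \<in> ?R\<^sup>*"
    using sym_rtrancl[OF symR] by (meson rtrancl_trans symD)
  moreover have "(w, v) \<in> ?R"
    using assms(2) \<open>u \<noteq> w\<close> neq by auto
  ultimately have "(u, v) \<in> ?R\<^sup>*"
    by (rule rtrancl_into_rtrancl)
  then show False
    using is_tree_bridge[OF tree assms(1)] by simp
qed

text \<open>An edge inside a level would give its end a second neighbour of no greater depth, next
  to its parent.\<close>

lemma depth_edge_cases: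
  assumes "(v, w) \<in> E"
  shows "depth E r w = Suc (depth E r v) \<or> depth E r v = Suc (depth E r w)"
proof -
  have "depth E r w \<noteq> depth E r v"
  proof
    assume eq: "depth E r w = depth E r v"
    have vw: "v \<in> V" "w \<in> V" "v \<noteq> w" "(w, v) \<in> E"
      using assms is_tree_edge_verts[OF tree] is_tree_irrefl[OF tree] is_tree_sym[OF tree] by blast+
    show False
    proof (cases "depth E r v")
      case 0
      then show ?thesis using depth_eq_0[of v] depth_eq_0[of w] vw eq by simp
    next
      case (Suc n)
      then obtain u where "(u, v) \<in> E" "depth E r u = n"
        using depth_pred vw by blast
      then show ?thesis
        using lower_neighbour_unique[of u v w] vw(4) eq Suc by simp
    qed
  qed
  moreover have "depth E r w \<le> Suc (depth E r v)" "depth E r v \<le> Suc (depth E r w)"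
    using depth_edge assms is_tree_sym[OF tree] by blast+
  ultimately show ?thesis by linarith
qed

text \<open>States of the vertices are chosen outwards from the root; in a tree no two choices ever have
  to be reconciled.\<close>

lemma tree_choice:
  fixes Q :: "'a \<Rightarrow> 's \<Rightarrow> bool" and C :: "'a \<Rightarrow> 's \<Rightarrow> 'a \<Rightarrow> 's \<Rightarrow> bool"
  assumes Q: "Q r s0"
    and C_sym: "\<And>v s w t. (v, w) \<in> E \<Longrightarrow> C v s w t \<Longrightarrow> C w t v s"
    and ext: "\<And>v w s. (v, w) \<in> E \<Longrightarrow> Q v s \<Longrightarrow> \<exists>t. Q w t \<and> C v s w t"
  shows "\<exists>\<phi>. \<phi> r = s0 \<and> (\<forall>v\<in>V. Q v (\<phi> v)) \<and> (\<forall>v w. (v, w) \<in> E \<longrightarrow> C v (\<phi> v) w (\<phi> w))"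
proof -
  define p where "p w = (SOME v. (v, w) \<in> E \<and> Suc (depth E r v) = depth E r w)" for w
  \<comment> \<open>The recursion runs over depths instead of vertices: each \<open>\<psi> n\<close>
    is defined on all vertices, but \<open>\<phi>\<close> reads only its values at vertices of depth
    \<open>n\<close>, where the parent \<open>p w\<close> has its state from the previous
    stage.\<close>
  define \<psi> where "\<psi> = rec_nat (\<lambda>_. s0) (\<lambda>n f w. SOME t. Q w t \<and> C (p w) (f (p w)) w t)"
  define \<phi> where "\<phi> v = \<psi> (depth E r v) v" for v
  have \<psi>_Suc: "\<psi> (Suc n) w = (SOME t. Q w t \<and> C (p w) (\<psi> n (p w)) w t)" for n w
    by (simp add: \<psi>_def)
  have p: "(p w, w) \<in> E \<and> Suc (depth E r (p w)) = depth E r w" if "w \<in> V" "w \<noteq> r" for w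
  proof -
    have "depth E r w \<noteq> 0" using that depth_eq_0 by blast
    then obtain n where "depth E r w = Suc n" by (cases "depth E r w") auto
    then have "\<exists>v. (v, w) \<in> E \<and> Suc (depth E r v) = depth E r w"
      using depth_pred[OF that(1)] by auto
    then show ?thesis
      unfolding p_def by (rule someI_ex)
  qed
  have "\<phi> r = s0"
    by (simp add: \<phi>_def depth_root \<psi>_def)
  have step: "Q w (\<phi> w) \<and> C (p w) (\<phi> (p w)) w (\<phi> w)" if "w \<in> V" "w \<noteq> r" "Q (p w) (\<phi> (p w))" for w
  proof -
    have "\<phi> w = (SOME t. Q w t \<and> C (p w) (\<phi> (p w)) w t)"
      using p[OF that(1,2)] \<psi>_Suc[of "depth E r (p w)" w] by (simp add: \<phi>_def)
    then show ?thesis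
      using someI_ex[OF ext[OF conjunct1[OF p[OF that(1,2)]] that(3)]] by simp
  qed
  have allQ: "Q v (\<phi> v)" if "v \<in> V" for v
    using that
  proof (induction "depth E r v" arbitrary: v)
    case 0
    then have "v = r" using depth_eq_0[of v] by simp
    then show ?case using Q \<open>\<phi> r = s0\<close> by simp
  next
    case (Suc n)
    then have "v \<noteq> r" using depth_root by auto
    then have "(p v, v) \<in> E" "n = depth E r (p v)"
      using Suc p[of v] by auto
    then have "Q (p v) (\<phi> (p v))"
      using Suc.hyps(1) is_tree_edge_verts[OF tree] by blast
    then show ?case using step Suc.prems \<open>v \<noteq> r\<close> by blast
  qed
  \<comment> \<open>The lower end of an upward edge is the unique parent of the upper end, so the
    relation holds by the way the state was chosen. Downward edges follow from
    \<open>C_sym\<close>.\<close>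
  have up: "C v (\<phi> v) w (\<phi> w)" if "(v, w) \<in> E" "depth E r w = Suc (depth E r v)" for v w
  proof -
    have w: "w \<in> V" "w \<noteq> r" using that is_tree_edge_verts[OF tree] depth_root by auto
    then have "p w = v"
      using lower_neighbour_unique[of "p w" w v] p[OF w] that by simp
    then show ?thesis
      using step[OF w] allQ that(1) is_tree_edge_verts[OF tree] by blast
  qed
  have "C v (\<phi> v) w (\<phi> w)" if "(v, w) \<in> E" for v w
    using depth_edge_cases[OF that] up[OF that] up[of w v] C_sym[of w v] is_tree_sym[OF tree that] by blast
  with \<open>\<phi> r = s0\<close> allQ show ?thesis by blast
qed

end

section \<open>Local isomorphisms of trees\<close>

text \<open>Local injectivity keeps a path without backtracking free of backtracking, and in a tree
  such a path is geodesic; so the map is an isometry.\<close>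

lemma tree_local_inj_depth:
  assumes tree: "is_tree V E"
    and gE: "\<And>v w. (v, w) \<in> E \<Longrightarrow> (g v, g w) \<in> E"
    and g_inj: "\<And>v. v \<in> V \<Longrightarrow> inj_on g (E `` {v})"
    and gV: "g ` V \<subseteq> V" and v: "v \<in> V" and u: "u \<in> V"
  shows "depth E (g v) (g u) = depth E v u"
  using u
proof (induction "depth E v u" arbitrary: u rule: less_induct)
  case less
  have gv: "g v \<in> V" using gV v by blast
  show ?case
  proof (cases "depth E v u")
    case 0
    then show ?thesis
      using depth_eq_0[OF tree v less.prems] depth_root[OF tree gv] by simp
  next
    case (Suc n)
    then obtain w where w: "(w, u) \<in> E" "depth E v w = n"
      using depth_pred[OF tree v less.prems] by blast
    have wV: "w \<in> V" using is_tree_edge_verts[OF tree w(1)] by simp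
    have gw: "depth E (g v) (g w) = n"
      using less.hyps[of w] w Suc wV by simp
    show ?thesis
    proof (cases n)
      case 0
      then have "w = v" using depth_eq_0[OF tree v wV] w(2) by simp
      then show ?thesis
        using depth_edge_cases[OF tree gv gE[OF w(1)]] gw Suc 0 by simp
    next
      case (Suc m)
      then obtain x where x: "(x, w) \<in> E" "depth E v x = m"
        using depth_pred[OF tree v wV] w(2) by blast
      have gx: "depth E (g v) (g x) = m"
        using less.hyps[of x] x Suc \<open>depth E v u = Suc n\<close> is_tree_edge_verts[OF tree x(1)] by simp
      \<comment> \<open>The image of \<open>x\<close> already is the only neighbour of
        \<open>g w\<close> that is not farther from \<open>g v\<close> than \<open>g w\<close>.
        Since \<open>g u\<close> differs from it, \<open>g u\<close> is one step farther
        out.\<close>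
      have "x \<noteq> u" using x(2) \<open>depth E v u = Suc n\<close> Suc by auto
      then have "g x \<noteq> g u"
        using inj_onD[OF g_inj[OF wV], of x u] x(1) w(1) is_tree_sym[OF tree] by blast
      then have "\<not> depth E (g v) (g u) \<le> depth E (g v) (g w)"
        using lower_neighbour_unique[OF tree gv, of "g x" "g w" "g u"] gE[OF x(1)]
          gE[OF is_tree_sym[OF tree w(1)]] gx gw Suc by auto
      then show ?thesis
        using depth_edge_cases[OF tree gv gE[OF w(1)]] gw \<open>depth E v u = Suc n\<close> by auto
    qed
  qed
qed

text \<open>The map is a covering of a tree by a tree, hence an isomorphism: it is injective because
  it preserves distances, and surjective because its image is closed under passing to neighbours and
  the tree is connected.\<close>

lemma tree_local_iso_automorphism:
  assumes tree: "is_tree V E" and gV: "g ` V \<subseteq> V" and out: "\<And>v. v \<notin> V \<Longrightarrow> g v = v"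
    and bij: "\<And>v. v \<in> V \<Longrightarrow> bij_betw g (E `` {v}) (E `` {g v})"
  shows "g \<in> graph_aut V E"
proof -
  have gE: "(g v, g w) \<in> E" if "(v, w) \<in> E" for v w
    using bij_betwE[OF bij[of v]] that is_tree_edge_verts[OF tree that] by blast
  have depth_g: "depth E (g v) (g u) = depth E v u" if "v \<in> V" "u \<in> V" for v u
    using tree_local_inj_depth[OF tree gE _ gV that] bij bij_betw_imp_inj_on by blast
  have inj: "inj_on g V"
  proof (rule inj_onI)
    fix v u assume vu: "v \<in> V" "u \<in> V" "g v = g u"
    then have "depth E v u = 0"
      using depth_g[of v u] depth_root[OF tree, of "g v"] gV by auto
    then show "v = u"
      using depth_eq_0[OF tree vu(1,2)] by simp
  qed
  obtain v0 where v0: "v0 \<in> V" using tree by (auto simp: is_tree_def)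
  have "w \<in> g ` V" if "(g v0, w) \<in> E\<^sup>*" for w
    using that
  proof (induction rule: rtrancl_induct)
    case base
    then show ?case using v0 by blast
  next
    case (step x y)
    then obtain v where v: "v \<in> V" "x = g v" by blast
    then have "y \<in> g ` (E `` {v})"
      using bij_betw_imp_surj_on[OF bij[OF v(1)]] step by blast
    then show ?case using is_tree_edge_verts[OF tree] by blast
  qed
  then have surj: "g ` V = V"
    using is_tree_connected[OF tree] v0 gV by blast
  have "g permutes V"
    using inj surj out by (intro bij_imp_permutes) (auto simp: bij_betw_def)
  moreover have "(x, y) \<in> E" if "x \<in> V" "y \<in> V" "(g x, g y) \<in> E" for x y
  proof -
    have "g y \<in> g ` (E `` {x})"
      using bij_betw_imp_surj_on[OF bij[OF that(1)]] that by blast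
    then obtain z where "(x, z) \<in> E" "g y = g z" by blast
    then show ?thesis
      using inj_onD[OF inj, of y z] that is_tree_edge_verts[OF tree] by blast
  qed
  ultimately show ?thesis
    using gE by (auto simp: graph_aut_def)
qed

lemma graph_aut_bij_neighbours:
  assumes g: "g \<in> graph_aut V E" and E: "E \<subseteq> V \<times> V" and v: "v \<in> V"
  shows "bij_betw g (E `` {v}) (E `` {g v})"
proof -
  have perm: "g permutes V" and iff: "\<And>x y. x \<in> V \<Longrightarrow> y \<in> V \<Longrightarrow> (g x, g y) \<in> E \<longleftrightarrow> (x, y) \<in> E"
    using g by (auto simp: graph_aut_def)
  have "g ` (E `` {v}) = E `` {g v}"
  proof (intro equalityI subsetI)
    fix y assume "y \<in> E `` {g v}"
    then have "y \<in> g ` V" using E permutes_image[OF perm] by auto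
    then show "y \<in> g ` (E `` {v})" using iff v \<open>y \<in> E `` {g v}\<close> by auto
  qed (use E iff v in auto)
  then show ?thesis
    using permutes_inj_on[OF perm] by (simp add: bij_betw_def)
qed

lemma graph_aut_comp: "g \<in> graph_aut V E \<Longrightarrow> h \<in> graph_aut V E \<Longrightarrow> h \<circ> g \<in> graph_aut V E"
  by (auto simp: graph_aut_def permutes_compose permutes_in_image)

lemma id_graph_aut: "id \<in> graph_aut V E"
  by (simp add: graph_aut_def permutes_id)

lemma gsphere_1: "(v, v) \<notin> E \<Longrightarrow> gsphere E v 1 = E `` {v}"
  by (auto simp: gsphere_def)

lemma gball_1: "gball E v 1 = insert v (E `` {v})"
  by (auto simp: gball_def le_Suc_eq)

lemma gball_2: "gball E v 2 = insert v (E `` {v} \<union> E `` (E `` {v}))"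
  by (fastforce simp: gball_def le_Suc_eq numeral_2_eq_2)

section \<open>Local permutations and rooted trees\<close>

lemma local_perm_apply:
  "inj_on i (gsphere E v 1) \<Longrightarrow> x \<in> gsphere E v 1 \<Longrightarrow> local_perm E i g v (i x) = i (g x)"
  by (simp add: local_perm_def perm_restrict_def)

lemma local_perm_outside: "c \<notin> i ` gsphere E v 1 \<Longrightarrow> local_perm E i g v c = c"
  by (simp add: local_perm_def perm_restrict_def)

lemma local_perm_cong:
  assumes "\<And>x. x \<in> gsphere E v 1 \<Longrightarrow> g x = h x"
  shows "local_perm E i g v = local_perm E i h v"
proof
  fix c
  show "local_perm E i g v c = local_perm E i h v c"
  proof (cases "c \<in> i ` gsphere E v 1")
    case True
    then show ?thesis
      using assms inv_into_into[OF True] by (simp add: local_perm_def perm_restrict_def)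
  qed (simp add: local_perm_outside)
qed

lemma local_perm_id: "inj_on i (gsphere E v 1) \<Longrightarrow> local_perm E i id v = id"
  by (auto simp: fun_eq_iff local_perm_def perm_restrict_def)

lemma local_perm_permutes:
  assumes i: "bij_betw i (gsphere E v 1) C" and i': "bij_betw i S C"
    and g: "bij_betw g (gsphere E v 1) S"
  shows "local_perm E i g v permutes C"
proof (rule bij_imp_permutes)
  have "bij_betw (i \<circ> g \<circ> inv_into (gsphere E v 1) i) C C"
    by (intro bij_betw_trans[OF bij_betw_inv_into[OF i]] bij_betw_trans[OF g] i')
  then show "bij_betw (local_perm E i g v) C C"
    by (rule bij_betw_cong[THEN iffD1, rotated])
      (use i in \<open>auto simp: local_perm_def perm_restrict_def bij_betw_def\<close>)
qed (use i local_perm_outside in \<open>auto simp: bij_betw_def\<close>)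

text \<open>The cocycle rule for local permutations. The same set of colors has to occur around
  \<open>v\<close> and \<open>g v\<close>, so that both factors are extended by the identity from
  the same set.\<close>

lemma local_perm_comp:
  assumes i: "inj_on i (gsphere E v 1)" and i': "inj_on i (gsphere E (g v) 1)"
    and im: "i ` gsphere E v 1 = i ` gsphere E (g v) 1"
    and g: "g ` gsphere E v 1 \<subseteq> gsphere E (g v) 1"
  shows "local_perm E i (h \<circ> g) v = local_perm E i h (g v) \<circ> local_perm E i g v"
proof
  fix c
  show "local_perm E i (h \<circ> g) v c = (local_perm E i h (g v) \<circ> local_perm E i g v) c"
  proof (cases "c \<in> i ` gsphere E v 1")
    case True
    then obtain x where "x \<in> gsphere E v 1" "c = i x" by blast
    then show ?thesis
      using g i i' by (simp add: local_perm_apply image_subset_iff)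
  next
    case False
    then show ?thesis using im by (simp add: local_perm_outside)
  qed
qed

lemma evenperm_local_perm_comp:
  assumes i: "bij_betw i (gsphere E v 1) C" "bij_betw i (gsphere E (g v) 1) C"
      "bij_betw i (gsphere E (h (g v)) 1) C"
    and g: "bij_betw g (gsphere E v 1) (gsphere E (g v) 1)"
    and h: "bij_betw h (gsphere E (g v) 1) (gsphere E (h (g v)) 1)"
    and C: "finite C"
  shows "evenperm (local_perm E i (h \<circ> g) v) \<longleftrightarrow>
    (evenperm (local_perm E i h (g v)) \<longleftrightarrow> evenperm (local_perm E i g v))"
proof -
  have "local_perm E i (h \<circ> g) v = local_perm E i h (g v) \<circ> local_perm E i g v"
    using i g by (intro local_perm_comp) (auto simp: bij_betw_def)
  moreover have "permutation (local_perm E i h (g v))" "permutation (local_perm E i g v)"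
    using local_perm_permutes[OF i(2,3) h] local_perm_permutes[OF i(1,2) g] C
    by (auto simp: permutation_permutes)
  ultimately show ?thesis
    by (simp add: evenperm_comp)
qed

section \<open>Automorphisms of rooted trees of depth two and their parities\<close>

definition rt_leaves_at :: "nat \<Rightarrow> nat \<Rightarrow> rvertex set" where
  "rt_leaves_at e a = RLeaf a ` {..<e - 1}"

lemma rt_neighbours:
  shows rt_neighbours_root: "rt_edges d e `` {RRoot} = rt_children d"
    and rt_neighbours_child: "a < d \<Longrightarrow> rt_edges d e `` {RChild a} = insert RRoot (rt_leaves_at e a)"
  by (auto simp: rt_edges_def rt_down_def rt_children_def rt_leaves_at_def)

lemma rt_edges_irrefl: "(x, x) \<notin> rt_edges d e"
  by (auto simp: rt_edges_def rt_down_def)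

lemma rt_edges_subset: "rt_edges d e \<subseteq> rt_verts d e \<times> rt_verts d e"
  by (auto simp: rt_edges_def rt_down_def rt_verts_def rt_children_def rt_leaves_def)

lemma rt_gsphere:
  shows rt_gsphere_root: "gsphere (rt_edges d e) RRoot 1 = rt_children d"
    and rt_gsphere_child: "a < d \<Longrightarrow> gsphere (rt_edges d e) (RChild a) 1 = insert RRoot (rt_leaves_at e a)"
  by (simp_all only: gsphere_1[OF rt_edges_irrefl] rt_neighbours)

lemma rt_gball_root: "gball (rt_edges d e) RRoot 1 = insert RRoot (rt_children d)"
  by (simp only: gball_1 rt_neighbours)

lemma rt_verts_simps [simp]:
  "RRoot \<in> rt_verts d e" "RChild a \<in> rt_verts d e \<longleftrightarrow> a < d"
  "RLeaf a b \<in> rt_verts d e \<longleftrightarrow> a < d \<and> b < e - 1"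
  "RChild a \<in> rt_children d \<longleftrightarrow> a < d" "RRoot \<notin> rt_children d" "RLeaf a b \<notin> rt_children d"
  "RLeaf a' b \<in> rt_leaves_at e a \<longleftrightarrow> a' = a \<and> b < e - 1" "RRoot \<notin> rt_leaves_at e a" "RChild a' \<notin> rt_leaves_at e a"
  by (auto simp: rt_verts_def rt_children_def rt_leaves_def rt_leaves_at_def)

lemma finite_rt_verts: "finite (rt_verts d e)"
proof -
  have "rt_verts d e \<subseteq> insert RRoot (RChild ` {..<d} \<union> case_prod RLeaf ` ({..<d} \<times> {..<e - 1}))"
    by (auto simp: rt_verts_def rt_children_def rt_leaves_def)
  then show ?thesis by (rule finite_subset) simp
qed

lemma rt_children_bij_index:
  assumes "bij_betw F (rt_children d) (rt_children d)"
  shows "\<exists>\<pi>. \<pi> permutes {..<d} \<and> (\<forall>a<d. F (RChild a) = RChild (\<pi> a))"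
proof -
  have RChild: "bij_betw RChild {..<d} (rt_children d)"
    by (auto simp: bij_betw_def inj_on_def rt_children_def)
  define \<pi> where "\<pi> a = (if a < d then inv_into {..<d} RChild (F (RChild a)) else a)" for a
  have "bij_betw (inv_into {..<d} RChild \<circ> F \<circ> RChild) {..<d} {..<d}"
    by (intro bij_betw_trans[OF RChild] bij_betw_trans[OF assms] bij_betw_inv_into[OF RChild])
  then have "bij_betw \<pi> {..<d} {..<d}"
    by (rule bij_betw_cong[THEN iffD1, rotated]) (simp add: \<pi>_def)
  then have "\<pi> permutes {..<d}"
    by (rule bij_imp_permutes) (simp add: \<pi>_def)
  moreover have "F (RChild a) = RChild (\<pi> a)" if "a < d" for a
  proof -
    have "F (RChild a) \<in> RChild ` {..<d}"
      using bij_betwE[OF assms] that RChild by (simp add: bij_betw_def)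
    then show ?thesis using that by (simp add: \<pi>_def f_inv_into_f)
  qed
  ultimately show ?thesis by blast
qed

lemma rt_autD:
  assumes "g \<in> rt_aut d e"
  shows rt_aut_root: "g RRoot = RRoot"
    and rt_aut_permutes: "g permutes rt_verts d e"
    and rt_aut_bij_neighbours: "v \<in> rt_verts d e \<Longrightarrow> bij_betw g (rt_edges d e `` {v}) (rt_edges d e `` {g v})"
  using assms graph_aut_bij_neighbours[OF _ rt_edges_subset]
  by (auto simp: rt_aut_def graph_aut_def)

lemma rt_aut_comp: "g \<in> rt_aut d e \<Longrightarrow> h \<in> rt_aut d e \<Longrightarrow> h \<circ> g \<in> rt_aut d e"
  by (auto simp: rt_aut_def graph_aut_comp)

lemma rt_aut_id: "id \<in> rt_aut d e"
  by (simp add: rt_aut_def id_graph_aut)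

lemma rt_aut_bij_children: "g \<in> rt_aut d e \<Longrightarrow> bij_betw g (rt_children d) (rt_children d)"
  using rt_aut_bij_neighbours[of g d e RRoot] by (simp add: rt_aut_root rt_neighbours_root)

lemma rt_aut_index:
  "g \<in> rt_aut d e \<Longrightarrow> \<exists>\<pi>. \<pi> permutes {..<d} \<and> (\<forall>a<d. g (RChild a) = RChild (\<pi> a))"
  by (intro rt_children_bij_index rt_aut_bij_children)

lemma rt_aut_child_in: "g \<in> rt_aut d e \<Longrightarrow> x \<in> rt_children d \<Longrightarrow> g x \<in> rt_children d"
  using bij_betwE[OF rt_aut_bij_children] by blast

lemma rt_aut_bij_sphere:
  assumes g: "g \<in> rt_aut d e" and x: "x \<in> rt_children d"
  shows "bij_betw g (gsphere (rt_edges d e) x 1) (gsphere (rt_edges d e) (g x) 1)"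
  using rt_aut_bij_neighbours[OF g, of x] x
  by (auto simp: gsphere_1[OF rt_edges_irrefl] rt_verts_def simp del: One_nat_def)

lemma rt_aut_bij_leaves_at:
  assumes g: "g \<in> rt_aut d e" and a: "a < d" "g (RChild a) = RChild a'"
  shows "bij_betw g (rt_leaves_at e a) (rt_leaves_at e a')"
proof -
  have a': "a' < d"
    using rt_aut_child_in[OF g, of "RChild a"] a by simp
  have "bij_betw g (insert RRoot (rt_leaves_at e a)) (insert RRoot (rt_leaves_at e a'))"
    using rt_aut_bij_neighbours[OF g, of "RChild a"] a a' by (simp add: rt_neighbours_child)
  then have "bij_betw g (insert RRoot (rt_leaves_at e a) - {RRoot}) (insert RRoot (rt_leaves_at e a') - {RRoot})"
    by (rule bij_betw_DiffI) (auto simp: bij_betw_def rt_aut_root[OF g])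
  then show ?thesis by simp
qed

lemma rt_aut_leaf:
  assumes "g \<in> rt_aut d e" "a < d" "g (RChild a) = RChild a'" "b < e - 1"
  shows "\<exists>b'<e - 1. g (RLeaf a b) = RLeaf a' b'"
  using bij_betwE[OF rt_aut_bij_leaves_at[OF assms(1-3)]] assms(4)
  by (auto simp: rt_leaves_at_def)

lemma rt_aut_eqI:
  assumes "g \<in> rt_aut d e" "h \<in> rt_aut d e"
    and "\<And>a. a < d \<Longrightarrow> g (RChild a) = h (RChild a)"
    and "\<And>a b. a < d \<Longrightarrow> b < e - 1 \<Longrightarrow> g (RLeaf a b) = h (RLeaf a b)"
  shows "g = h"
proof
  fix x show "g x = h x"
  proof (cases "x \<in> rt_verts d e")
    case True
    then show ?thesis
      using assms(3,4) rt_aut_root[OF assms(1)] rt_aut_root[OF assms(2)] by (cases x) auto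
  next
    case False
    then show ?thesis
      using rt_aut_permutes[OF assms(1)] rt_aut_permutes[OF assms(2)] by (simp add: permutes_not_in)
  qed
qed

definition rt_glue :: "nat \<Rightarrow> nat \<Rightarrow> (nat \<Rightarrow> nat) \<Rightarrow> (nat \<Rightarrow> nat \<Rightarrow> rvertex) \<Rightarrow> rvertex \<Rightarrow> rvertex" where
  "rt_glue d e \<pi> t z = (if z \<in> rt_verts d e then
     (case z of RRoot \<Rightarrow> RRoot | RChild a \<Rightarrow> RChild (\<pi> a) | RLeaf a b \<Rightarrow> t a b) else z)"

lemma rt_glue_simps:
  "a < d \<Longrightarrow> rt_glue d e \<pi> t (RChild a) = RChild (\<pi> a)"
  "a < d \<Longrightarrow> b < e - 1 \<Longrightarrow> rt_glue d e \<pi> t (RLeaf a b) = t a b"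
  "rt_glue d e \<pi> t RRoot = RRoot"
  by (simp_all add: rt_glue_def)

text \<open>The automorphism group is a wreath product: the permutation of the children and the
  bijections below the individual children can be prescribed independently.\<close>

lemma rt_glue_aut:
  assumes \<pi>: "\<pi> permutes {..<d}"
    and t: "\<And>a. a < d \<Longrightarrow> bij_betw (t a) {..<e - 1} (rt_leaves_at e (\<pi> a))"
  shows "rt_glue d e \<pi> t \<in> rt_aut d e"
proof -
  let ?g = "rt_glue d e \<pi> t"
  have \<pi>_lt: "\<pi> a < d \<longleftrightarrow> a < d" for a
    using permutes_in_image[OF \<pi>, of a] by simp
  have \<pi>_eq: "\<pi> a = \<pi> b \<longleftrightarrow> a = b" for a b
    using permutes_inj[OF \<pi>] by (auto simp: inj_def)
  \<comment> \<open>This reads off the position of the image leaf below its parent; the default 0 is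
    never reached for indices in range.\<close>
  define s where "s a b = (case t a b of RLeaf _ b' \<Rightarrow> b' | _ \<Rightarrow> 0)" for a b
  have s: "t a b = RLeaf (\<pi> a) (s a b)" "s a b < e - 1" if "a < d" "b < e - 1" for a b
  proof -
    have "t a b \<in> RLeaf (\<pi> a) ` {..<e - 1}"
      using bij_betwE[OF t[OF that(1)]] that(2) by (simp add: rt_leaves_at_def)
    then show "t a b = RLeaf (\<pi> a) (s a b)" "s a b < e - 1"
      by (auto simp: s_def)
  qed
  have s_eq: "s a b = s a b' \<longleftrightarrow> b = b'" if "a < d" "b < e - 1" "b' < e - 1" for a b b'
    using inj_on_eq_iff[OF bij_betw_imp_inj_on[OF t[OF that(1)]], of b b'] that s by simp
  have "inj_on ?g (rt_verts d e)"
  proof (rule inj_onI)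
    fix x y assume "x \<in> rt_verts d e" "y \<in> rt_verts d e" "?g x = ?g y"
    then show "x = y"
      by (cases x; cases y) (auto simp: rt_glue_simps \<pi>_eq s s_eq simp del: One_nat_def)
  qed
  moreover have "?g ` rt_verts d e \<subseteq> rt_verts d e"
  proof (rule image_subsetI)
    fix x assume "x \<in> rt_verts d e"
    then show "?g x \<in> rt_verts d e"
      by (cases x) (auto simp: rt_glue_simps \<pi>_lt s simp del: One_nat_def)
  qed
  ultimately have "bij_betw ?g (rt_verts d e) (rt_verts d e)"
    by (simp add: bij_betw_def endo_inj_surj finite_rt_verts)
  then have "?g permutes rt_verts d e"
    by (rule bij_imp_permutes) (simp add: rt_glue_def)
  moreover have "(?g x, ?g y) \<in> rt_edges d e \<longleftrightarrow> (x, y) \<in> rt_edges d e"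
    if "x \<in> rt_verts d e" "y \<in> rt_verts d e" for x y
    using that
    by (cases x; cases y)
      (auto simp: rt_glue_simps rt_edges_def rt_down_def \<pi>_lt \<pi>_eq s simp del: One_nat_def)
  ultimately show ?thesis
    by (simp add: rt_aut_def graph_aut_def rt_glue_simps)
qed

text \<open>The means of correcting parities: it fixes all children and exchanges the first two
  leaves below those whose index lies in \<open>W\<close>. There are two leaves to exchange as soon
  as \<open>e \<ge> 3\<close>.\<close>

definition rt_flip :: "nat \<Rightarrow> nat \<Rightarrow> nat set \<Rightarrow> rvertex \<Rightarrow> rvertex" where
  "rt_flip d e W = rt_glue d e id (\<lambda>a b. RLeaf a (if a \<in> W then Transposition.transpose 0 1 b else b))"

lemma rt_flip_aut: "e \<ge> 3 \<Longrightarrow> rt_flip d e W \<in> rt_aut d e"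
  unfolding rt_flip_def
proof (intro rt_glue_aut permutes_id)
  fix a assume "e \<ge> 3"
  let ?s = "\<lambda>b::nat. if a \<in> W then Transposition.transpose 0 1 b else b"
  have "?s permutes {..<e - 1}"
    using \<open>e \<ge> 3\<close> permutes_swap_id[of 0 "{..<e - 1}" 1] permutes_id[of "{..<e - 1}"]
    by (cases "a \<in> W") (auto simp: id_def)
  then have "bij_betw ?s {..<e - 1} {..<e - 1}"
    by (rule permutes_imp_bij)
  then have "bij_betw (RLeaf a \<circ> ?s) {..<e - 1} (rt_leaves_at e a)"
    by (rule bij_betw_trans) (auto simp: bij_betw_def inj_on_def rt_leaves_at_def)
  then show "bij_betw (\<lambda>b. RLeaf a (?s b)) {..<e - 1} (rt_leaves_at e (id a))"
    by (simp add: comp_def)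
qed

lemma rt_flip_simps:
  "a < d \<Longrightarrow> rt_flip d e W (RChild a) = RChild a"
  "a < d \<Longrightarrow> b < e - 1 \<Longrightarrow> rt_flip d e W (RLeaf a b) = RLeaf a (if a \<in> W then Transposition.transpose 0 1 b else b)"
  "rt_flip d e W RRoot = RRoot"
  by (simp_all add: rt_flip_def rt_glue_simps)

lemma rt_legal_coloring_bij:
  "rt_legal_coloring d e j \<Longrightarrow> x \<in> rt_children d \<Longrightarrow> bij_betw j (gsphere (rt_edges d e) x 1) {1..e}"
  by (simp add: rt_legal_coloring_def)

abbreviation rt_even :: "nat \<Rightarrow> nat \<Rightarrow> (rvertex \<Rightarrow> nat) \<Rightarrow> (rvertex \<Rightarrow> rvertex) \<Rightarrow> rvertex \<Rightarrow> bool" where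
  "rt_even d e j g x \<equiv> evenperm (local_perm (rt_edges d e) j g x)"

lemma rt_even_comp:
  assumes "rt_legal_coloring d e j" "g \<in> rt_aut d e" "h \<in> rt_aut d e" "x \<in> rt_children d"
  shows "rt_even d e j (h \<circ> g) x \<longleftrightarrow> (rt_even d e j h (g x) \<longleftrightarrow> rt_even d e j g x)"
proof -
  have "g x \<in> rt_children d" "h (g x) \<in> rt_children d"
    using assms(2-4) rt_aut_child_in by blast+
  with assms show ?thesis
    by (intro evenperm_local_perm_comp[where C = "{1..e}"] rt_legal_coloring_bij rt_aut_bij_sphere) auto
qed

lemma rt_even_id: "rt_legal_coloring d e j \<Longrightarrow> x \<in> rt_children d \<Longrightarrow> rt_even d e j id x"
  using bij_betw_imp_inj_on[OF rt_legal_coloring_bij] by (simp add: local_perm_id del: One_nat_def)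

text \<open>At a flipped child the local permutation is the transposition of the colors of the two
  exchanged leaves; at every other child it is the identity.\<close>

lemma rt_even_flip:
  assumes j: "rt_legal_coloring d e j" and e: "e \<ge> 3" and a: "a < d"
  shows "rt_even d e j (rt_flip d e W) (RChild a) \<longleftrightarrow> a \<notin> W"
proof -
  let ?S = "gsphere (rt_edges d e) (RChild a) 1"
  have S: "?S = insert RRoot (rt_leaves_at e a)"
    using a by (rule rt_gsphere_child)
  have inj: "inj_on j ?S"
    using bij_betw_imp_inj_on[OF rt_legal_coloring_bij[OF j, of "RChild a"]] a by simp
  show ?thesis
  proof (cases "a \<in> W")
    case True
    have in_S: "RLeaf a 0 \<in> ?S" "RLeaf a 1 \<in> ?S" "RRoot \<in> ?S"
      using e a by (simp_all only: S) auto
    have neq: "j (RLeaf a 0) \<noteq> j (RLeaf a 1)"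
      using inj_on_eq_iff[OF inj in_S(1,2)] by simp
    have "local_perm (rt_edges d e) j (rt_flip d e W) (RChild a) =
        Transposition.transpose (j (RLeaf a 0)) (j (RLeaf a 1))"
    proof
      fix c
      show "local_perm (rt_edges d e) j (rt_flip d e W) (RChild a) c =
          Transposition.transpose (j (RLeaf a 0)) (j (RLeaf a 1)) c"
      proof (cases "c \<in> j ` ?S")
        case True
        then obtain x where x: "x \<in> ?S" "c = j x" by blast
        have lp: "local_perm (rt_edges d e) j (rt_flip d e W) (RChild a) c = j (rt_flip d e W x)"
          unfolding x(2) by (rule local_perm_apply[OF inj x(1)])
        have x': "x = RRoot \<or> (\<exists>b<e - 1. x = RLeaf a b)"
          using x(1) unfolding S by (auto simp: rt_leaves_at_def)
        show ?thesis
        proof (cases "x = RLeaf a 0 \<or> x = RLeaf a 1")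
          case True
          then show ?thesis
            using lp x(2) a \<open>a \<in> W\<close> e by (auto simp: rt_flip_simps)
        next
          case False
          then have "rt_flip d e W x = x"
            using x' a by (auto simp: rt_flip_simps Transposition.transpose_def split: if_splits)
          moreover have "j x \<noteq> j (RLeaf a 0)" "j x \<noteq> j (RLeaf a 1)"
            using False inj_on_eq_iff[OF inj x(1) in_S(1)] inj_on_eq_iff[OF inj x(1) in_S(2)] by blast+
          ultimately show ?thesis
            using lp x(2) by (simp add: Transposition.transpose_def)
        qed
      next
        case False
        then have "c \<noteq> j (RLeaf a 0)" "c \<noteq> j (RLeaf a 1)" using in_S by blast+
        then show ?thesis using local_perm_outside[OF False] by (simp add: Transposition.transpose_def)
      qed
    qed
    then show ?thesis using neq True by (simp add: evenperm_swap)
  next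
    case False
    have "local_perm (rt_edges d e) j (rt_flip d e W) (RChild a) = local_perm (rt_edges d e) j id (RChild a)"
      by (rule local_perm_cong) (use False a in \<open>auto simp: S rt_leaves_at_def rt_flip_simps simp del: One_nat_def\<close>)
    then show ?thesis
      using False local_perm_id[OF inj] by simp
  qed
qed

text \<open>Precomposition with a flip below exactly those children where the parity is wrong. The
  clause on leaves records that nothing changes where the parity was right; it lets a prescribed
  star survive the correction.\<close>

lemma rt_aut_adjust_parity:
  assumes j: "rt_legal_coloring d e j" and e: "e \<ge> 3" and g: "g \<in> rt_aut d e"
  shows "\<exists>g'\<in>rt_aut d e. (\<forall>a<d. g' (RChild a) = g (RChild a) \<and> (rt_even d e j g' (RChild a) \<longleftrightarrow> P a) \<and>
    ((rt_even d e j g (RChild a) \<longleftrightarrow> P a) \<longrightarrow> (\<forall>b<e - 1. g' (RLeaf a b) = g (RLeaf a b))))"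
proof -
  define W where "W = {a. rt_even d e j g (RChild a) \<noteq> P a}"
  have "rt_even d e j (g \<circ> rt_flip d e W) (RChild a) \<longleftrightarrow> P a" if "a < d" for a
    using rt_even_comp[OF j rt_flip_aut[OF e] g, of "RChild a" W] rt_even_flip[OF j e that, of W] that
    by (auto simp: rt_flip_simps W_def)
  then show ?thesis
    by (intro bexI[of _ "g \<circ> rt_flip d e W"] rt_aut_comp rt_flip_aut e g)
      (auto simp: rt_flip_simps W_def)
qed

text \<open>Below each child there are only two leaves. Automorphisms that agree on the children can
  differ below a child only by the exchange of these two leaves, and this changes the parity. The
  uniqueness behind the definite description in \<open>f_map\<close> rests on this.\<close>

lemma rt_aut_3_eqI:
  assumes j: "rt_legal_coloring d 3 j" and h: "h \<in> rt_aut d 3" "h' \<in> rt_aut d 3"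
    and child: "\<And>a. a < d \<Longrightarrow> h (RChild a) = h' (RChild a)"
    and even: "\<And>a. a < d \<Longrightarrow> rt_even d 3 j h (RChild a) \<longleftrightarrow> rt_even d 3 j h' (RChild a)"
  shows "h = h'"
proof (rule rt_aut_eqI[OF h child])
  fix a b assume a: "a < d" and "b < (3::nat) - 1"
  then have b: "b = 0 \<or> b = 1" by auto
  obtain a' where a': "h (RChild a) = RChild a'"
    using rt_aut_index[OF h(1)] a by blast
  have L: "rt_leaves_at 3 c = {RLeaf c 0, RLeaf c 1}" for c
    by (auto simp: rt_leaves_at_def)
  have bij: "bij_betw h {RLeaf a 0, RLeaf a 1} {RLeaf a' 0, RLeaf a' 1}"
    "bij_betw h' {RLeaf a 0, RLeaf a 1} {RLeaf a' 0, RLeaf a' 1}"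
    using rt_aut_bij_leaves_at[OF h(1) a a'] rt_aut_bij_leaves_at[OF h(2) a] child[OF a] a'
    by (simp_all add: L)
  have "h (RLeaf a 0) = h' (RLeaf a 0) \<and> h (RLeaf a 1) = h' (RLeaf a 1)"
  proof (rule ccontr)
    assume neq: "\<not> ?thesis"
    have "{h (RLeaf a 0), h (RLeaf a 1)} = {h' (RLeaf a 0), h' (RLeaf a 1)}"
      using bij_betw_imp_surj_on[OF bij(1)] bij_betw_imp_surj_on[OF bij(2)] by simp
    with neq have swap: "h' (RLeaf a 0) = h (RLeaf a 1)" "h' (RLeaf a 1) = h (RLeaf a 0)"
      by (auto simp: doubleton_eq_iff)
    let ?\<tau> = "rt_flip d 3 {a}"
    have "local_perm (rt_edges d 3) j h' (RChild a) = local_perm (rt_edges d 3) j (h \<circ> ?\<tau>) (RChild a)"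
    proof (rule local_perm_cong)
      fix x assume "x \<in> gsphere (rt_edges d 3) (RChild a) 1"
      then have "x \<in> {RRoot, RLeaf a 0, RLeaf a 1}"
        by (simp only: rt_gsphere_child[OF a] L)
      then show "h' x = (h \<circ> ?\<tau>) x"
        using a swap rt_aut_root[OF h(1)] rt_aut_root[OF h(2)] by (auto simp: rt_flip_simps)
    qed
    moreover have "rt_even d 3 j (h \<circ> ?\<tau>) (RChild a) \<noteq> rt_even d 3 j h (RChild a)"
      using rt_even_comp[OF j rt_flip_aut h(1), of "RChild a" "{a}"] rt_even_flip[OF j _ a, of "{a}"] a
      by (simp add: rt_flip_simps)
    ultimately show False using even[OF a] by simp
  qed
  then show "h (RLeaf a b) = h' (RLeaf a b)" using b by auto
qed

section \<open>The linear action carried over to the tree with eight leaves\<close>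

lemma F3_same_line_iff:
  fixes u w :: F3_plane
  assumes "w \<noteq> 0"
  shows "(\<exists>c. w = c *s u) \<and> (\<exists>c. u = c *s w) \<longleftrightarrow> w = u \<or> w = - u"
proof
  assume "(\<exists>c. w = c *s u) \<and> (\<exists>c. u = c *s w)"
  then obtain c where c: "w = c *s u" by blast
  then have "c \<noteq> 0" using assms by auto
  then show "w = u \<or> w = - u"
    using c F3_exhaust[of c] by (auto simp: F3_plane_eq_iff)
next
  assume "w = u \<or> w = - u"
  then have "w = 1 *s u \<and> u = 1 *s w \<or> w = (-1) *s u \<and> u = (-1) *s w"
    by (auto simp: F3_plane_eq_iff)
  then show "(\<exists>c. w = c *s u) \<and> (\<exists>c. u = c *s w)" by blast
qed

lemma mult_vec_F3_inj:
  assumes "A \<in> SL2_F3" "A *v u = A *v w"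
  shows "u = w"
proof (rule ccontr)
  assume "u \<noteq> w"
  then have "A *v (u - w) \<noteq> 0" using SL2_F3_nonzero[OF assms(1)] by simp
  moreover have "A *v (u - w) = A *v u - A *v w"
    by (simp add: F3_plane_eq_iff mult_vec_F3 algebra_simps)
  ultimately show False using assms(2) by simp
qed

text \<open>The parent of the leaf labelled by \<open>u\<close>, which stands for the line through
  \<open>u\<close>. The default 0 does not arise for nonzero \<open>u\<close> under an admissible
  labelling.\<close>

definition line_of :: "(F3_plane \<Rightarrow> rvertex) \<Rightarrow> F3_plane \<Rightarrow> nat" where
  "line_of \<psi> u = (case \<psi> u of RLeaf a b \<Rightarrow> a | _ \<Rightarrow> 0)"

text \<open>Translation from the permutation groups, which act on numbers from 1 on, to the indices
  of children, which start at 0.\<close>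

lemma permutes_shift:
  assumes "k permutes {1..n}"
  shows "(\<lambda>a. if a < n then k (Suc a) - 1 else a) permutes {..<n}"
proof (rule bij_imp_permutes)
  have "bij_betw Suc {..<n} {1..n}"
    by (simp add: bij_betw_def image_Suc_lessThan)
  moreover have "bij_betw (\<lambda>x. x - 1) {1..n} {..<n}"
    by (rule bij_betw_byWitness[where f' = Suc]) auto
  ultimately have "bij_betw ((\<lambda>x. x - 1) \<circ> (k \<circ> Suc)) {..<n} {..<n}"
    using permutes_imp_bij[OF assms] by (blast intro: bij_betw_trans)
  then show "bij_betw (\<lambda>a. if a < n then k (Suc a) - 1 else a) {..<n} {..<n}"
    by (rule bij_betw_cong[THEN iffD1, rotated]) simp
qed simp

lemma rt_permute_star:
  assumes \<pi>: "\<pi> permutes {..<d}" and c: "c < d"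
    and t: "bij_betw t (rt_leaves_at e c) (rt_leaves_at e (\<pi> c))"
  shows "\<exists>g\<in>rt_aut d e. (\<forall>a<d. g (RChild a) = RChild (\<pi> a)) \<and> (\<forall>b<e - 1. g (RLeaf c b) = t (RLeaf c b))"
proof -
  have bij: "bij_betw (RLeaf a) {..<e - 1} (rt_leaves_at e a)" for a
    by (auto simp: bij_betw_def inj_on_def rt_leaves_at_def)
  define s where "s a = (if a = c then t \<circ> RLeaf c else RLeaf (\<pi> a))" for a
  have "bij_betw (s a) {..<e - 1} (rt_leaves_at e (\<pi> a))" for a
    using bij_betw_trans[OF bij t] bij by (cases "a = c") (simp_all add: s_def)
  then have "rt_glue d e \<pi> s \<in> rt_aut d e"
    by (intro rt_glue_aut \<pi>)
  then show ?thesis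
    using c by (intro bexI[of _ "rt_glue d e \<pi> s"]) (simp_all add: rt_glue_simps s_def)
qed

lemma rt_permute:
  assumes \<pi>: "\<pi> permutes {..<d}"
  shows "\<exists>g\<in>rt_aut d e. \<forall>a<d. g (RChild a) = RChild (\<pi> a)"
proof -
  have bij: "bij_betw (RLeaf a) {..<e - 1} (rt_leaves_at e a)" for a
    by (auto simp: bij_betw_def inj_on_def rt_leaves_at_def)
  have "rt_glue d e \<pi> (\<lambda>a. RLeaf (\<pi> a)) \<in> rt_aut d e"
    by (intro rt_glue_aut \<pi> bij)
  then show ?thesis
    by (intro bexI[of _ "rt_glue d e \<pi> (\<lambda>a. RLeaf (\<pi> a))"]) (simp_all add: rt_glue_simps)
qed

context
  fixes \<psi> :: "F3_plane \<Rightarrow> rvertex"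
  assumes \<psi>: "admissible_labelling \<psi>"
begin

lemma \<psi>_bij: "bij_betw \<psi> (UNIV - {0}) (rt_leaves 4 3)"
  using \<psi> by (simp add: admissible_labelling_def)

lemma \<psi>_leaf_less:
  assumes "u \<noteq> 0"
  shows "(\<exists>b<2. \<psi> u = RLeaf (line_of \<psi> u) b) \<and> line_of \<psi> u < 4"
proof -
  have "\<psi> u \<in> rt_leaves 4 3" using bij_betwE[OF \<psi>_bij] assms by simp
  then show ?thesis by (auto simp: rt_leaves_def line_of_def)
qed

lemma \<psi>_leaf: "u \<noteq> 0 \<Longrightarrow> \<exists>b<2. \<psi> u = RLeaf (line_of \<psi> u) b"
  and line_of_less: "u \<noteq> 0 \<Longrightarrow> line_of \<psi> u < 4"
  using \<psi>_leaf_less by blast+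

lemma \<psi>_inj: "u \<noteq> 0 \<Longrightarrow> w \<noteq> 0 \<Longrightarrow> \<psi> u = \<psi> w \<longleftrightarrow> u = w"
  using inj_on_eq_iff[OF bij_betw_imp_inj_on[OF \<psi>_bij]] by simp

lemma \<psi>_surj:
  assumes "a < 4" "b < 2"
  shows "\<exists>u. u \<noteq> 0 \<and> \<psi> u = RLeaf a b \<and> line_of \<psi> u = a"
proof -
  have "RLeaf a b \<in> \<psi> ` (UNIV - {0})"
    using assms bij_betw_imp_surj_on[OF \<psi>_bij] by (auto simp: rt_leaves_def)
  then obtain u where "u \<in> UNIV - {0}" "RLeaf a b = \<psi> u" by blast
  then have "u \<noteq> 0" "\<psi> u = RLeaf a b" by simp_all
  then show ?thesis by (auto simp: line_of_def intro!: exI[of _ u])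
qed

lemma line_of_eq_iff:
  assumes "u \<noteq> 0" "w \<noteq> 0"
  shows "line_of \<psi> u = line_of \<psi> w \<longleftrightarrow> w = u \<or> w = - u"
proof -
  have "line_of \<psi> u = line_of \<psi> w \<longleftrightarrow> (\<exists>a b b'. \<psi> u = RLeaf a b \<and> \<psi> w = RLeaf a b')"
    using \<psi>_leaf[OF assms(1)] \<psi>_leaf[OF assms(2)] by auto
  also have "\<dots> \<longleftrightarrow> (\<exists>c. w = c *s u) \<and> (\<exists>c. u = c *s w)"
    using \<psi> assms by (simp add: admissible_labelling_def)
  finally show ?thesis
    by (simp only: F3_same_line_iff[OF assms(2)])
qed

lemma line_numbering_line_of: "line_numbering (\<lambda>u. Suc (line_of \<psi> u))"
proof -
  have "(\<lambda>u. Suc (line_of \<psi> u)) ` (UNIV - {0}) = {1..4}"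
  proof (intro equalityI subsetI)
    fix x :: nat assume "x \<in> {1..4}"
    then have "x - 1 < 4" by auto
    then obtain u where "u \<noteq> 0" "line_of \<psi> u = x - 1"
      using \<psi>_surj[of "x - 1" 0] by auto
    then show "x \<in> (\<lambda>u. Suc (line_of \<psi> u)) ` (UNIV - {0})"
      using \<open>x \<in> {1..4}\<close> by (intro image_eqI[of _ _ u]) auto
  qed (use line_of_less in force)
  then show ?thesis
    using line_of_eq_iff by (simp add: line_numbering_def)
qed

text \<open>A linear map sends lines to lines, so its action on the eight leaves descends to their
  parents and is a rooted automorphism. Below each child, injectivity is enough for a bijection
  because both sides have two leaves.\<close>

lemma SL2_F3_acts:
  assumes A: "A \<in> SL2_F3"
  shows "\<exists>h\<in>G0_tilde \<psi>. \<forall>u. u \<noteq> 0 \<longrightarrow> h (\<psi> u) = \<psi> (A *v u)"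
proof -
  obtain k where k: "k permutes {1..4}" "\<And>u. u \<noteq> 0 \<Longrightarrow> k (Suc (line_of \<psi> u)) = Suc (line_of \<psi> (A *v u))"
    using SL2_F3_induces_line_perm[OF line_numbering_line_of A] by auto
  define \<pi> where "\<pi> a = (if a < 4 then k (Suc a) - 1 else a)" for a
  have \<pi>: "\<pi> permutes {..<4}"
    unfolding \<pi>_def by (rule permutes_shift[OF k(1)])
  define r where "r a b = inv_into (UNIV - {0}) \<psi> (RLeaf a b)" for a b
  have r: "r a b \<noteq> 0 \<and> \<psi> (r a b) = RLeaf a b" if "a < 4" "b < 2" for a b
  proof -
    have "RLeaf a b \<in> \<psi> ` (UNIV - {0})"
      using that bij_betw_imp_surj_on[OF \<psi>_bij] by (auto simp: rt_leaves_def)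
    from inv_into_into[OF this] f_inv_into_f[OF this] show ?thesis
      by (simp add: r_def)
  qed
  have \<psi>r: "r (line_of \<psi> u) b = u" if "u \<noteq> 0" "\<psi> u = RLeaf (line_of \<psi> u) b" for u b
    using inv_into_f_f[OF bij_betw_imp_inj_on[OF \<psi>_bij], of u] that by (simp add: r_def)
  define t where "t a b = \<psi> (A *v r a b)" for a b
  have "bij_betw (t a) {..<3 - 1} (rt_leaves_at 3 (\<pi> a))" if "a < 4" for a
  proof -
    have inj: "inj_on (t a) {..<3 - 1}"
    proof (rule inj_onI)
      fix b b' :: nat assume b: "b \<in> {..<3 - 1}" "b' \<in> {..<3 - 1}" "t a b = t a b'"
      then have "A *v r a b = A *v r a b'"
        using r[OF that] SL2_F3_nonzero[OF A] by (simp add: t_def \<psi>_inj)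
      then have "r a b = r a b'" by (rule mult_vec_F3_inj[OF A])
      then have "\<psi> (r a b) = \<psi> (r a b')" by (rule arg_cong)
      moreover have "\<psi> (r a b) = RLeaf a b" "\<psi> (r a b') = RLeaf a b'"
        using r[OF that] b(1,2) by simp_all
      ultimately show "b = b'" by simp
    qed
    have "t a b \<in> rt_leaves_at 3 (\<pi> a)" if "b < 2" for b
    proof -
      have "line_of \<psi> (r a b) = a"
        using r[OF \<open>a < 4\<close> that] by (simp add: line_of_def)
      then have "line_of \<psi> (A *v r a b) = \<pi> a"
        using k(2)[of "r a b"] r[OF \<open>a < 4\<close> that] \<open>a < 4\<close> by (simp add: \<pi>_def)
      then show ?thesis
        using \<psi>_leaf[OF SL2_F3_nonzero[OF A], of "r a b"] r[OF \<open>a < 4\<close> that]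
        by (auto simp: t_def rt_leaves_at_def)
    qed
    then have "t a ` {..<3 - 1} \<subseteq> rt_leaves_at 3 (\<pi> a)" by auto
    moreover have "card (rt_leaves_at 3 (\<pi> a)) = card (t a ` {..<3 - 1})"
      by (simp only: card_image[OF inj] rt_leaves_at_def) (simp add: card_image inj_on_def)
    moreover have "finite (rt_leaves_at 3 (\<pi> a))" by (simp add: rt_leaves_at_def)
    ultimately show ?thesis
      using inj card_subset_eq[of "rt_leaves_at 3 (\<pi> a)" "t a ` {..<3 - 1}"] by (simp add: bij_betw_def)
  qed
  then have h: "rt_glue 4 3 \<pi> t \<in> rt_aut 4 3"
    by (intro rt_glue_aut \<pi>)
  have "rt_glue 4 3 \<pi> t (\<psi> u) = \<psi> (A *v u)" if "u \<noteq> 0" for u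
  proof -
    obtain b where b: "b < 2" "\<psi> u = RLeaf (line_of \<psi> u) b"
      using \<psi>_leaf[OF \<open>u \<noteq> 0\<close>] by blast
    have "rt_glue 4 3 \<pi> t (RLeaf (line_of \<psi> u) b) = t (line_of \<psi> u) b"
      by (rule rt_glue_simps(2)) (use line_of_less[OF that] b in auto)
    then show ?thesis
      using \<psi>r[OF that b(2)] b(2) by (simp add: t_def)
  qed
  with h A show ?thesis
    by (intro bexI[of _ "rt_glue 4 3 \<pi> t"]) (auto simp: G0_tilde_def)
qed

lemma G0_tilde_line:
  assumes h: "h \<in> rt_aut 4 3" and u: "u \<noteq> 0" "w \<noteq> 0" "h (\<psi> u) = \<psi> w"
  shows "h (RChild (line_of \<psi> u)) = RChild (line_of \<psi> w)"
proof -
  obtain \<pi> where \<pi>: "\<And>a. a < 4 \<Longrightarrow> h (RChild a) = RChild (\<pi> a)"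
    using rt_aut_index[OF h] by blast
  obtain b b' where b: "b < 2" "\<psi> u = RLeaf (line_of \<psi> u) b" "\<psi> w = RLeaf (line_of \<psi> w) b'"
    using \<psi>_leaf[OF u(1)] \<psi>_leaf[OF u(2)] by blast
  have "\<exists>b'<3 - 1. h (RLeaf (line_of \<psi> u) b) = RLeaf (\<pi> (line_of \<psi> u)) b'"
    using b(1) by (intro rt_aut_leaf[OF h] \<pi> line_of_less u) auto
  then show ?thesis
    using b u(3) \<pi>[OF line_of_less[OF u(1)]] by auto
qed

text \<open>The expression \<open>k (Suc a) - 1\<close> is the permutation \<open>k\<close> read on
  the indices of children, which start at 0; the assertion is then the evenness of the action on
  lines.\<close>

lemma G0_tilde_even:
  assumes h: "h \<in> G0_tilde \<psi>" and k: "k permutes {1..4}"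
    and hk: "\<And>a. a < 4 \<Longrightarrow> h (RChild a) = RChild (k (Suc a) - 1)"
  shows "evenperm k"
proof -
  obtain A where A: "A \<in> SL2_F3" "\<And>u. u \<noteq> 0 \<Longrightarrow> h (\<psi> u) = \<psi> (A *v u)" and haut: "h \<in> rt_aut 4 3"
    using h by (auto simp: G0_tilde_def)
  show ?thesis
  proof (rule SL2_F3_lines_even[OF line_numbering_line_of A(1) k])
    fix u :: F3_plane assume u: "u \<noteq> 0"
    have "k (Suc (line_of \<psi> u)) - 1 = line_of \<psi> (A *v u)"
      using G0_tilde_line[OF haut u SL2_F3_nonzero[OF A(1) u] A(2)[OF u]] hk[OF line_of_less[OF u]]
      by simp
    moreover have "k (Suc (line_of \<psi> u)) \<in> {1..4}"
      using permutes_in_image[OF k, of "Suc (line_of \<psi> u)"] line_of_less[OF u] by simp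
    ultimately show "k (Suc (line_of \<psi> u)) = Suc (line_of \<psi> (A *v u))" by auto
  qed
qed

lemma G0_tilde_realizes_even:
  assumes "k permutes {1..4}" "evenperm k"
  shows "\<exists>h\<in>G0_tilde \<psi>. \<forall>a<4. h (RChild a) = RChild (k (Suc a) - 1)"
proof -
  obtain A where A: "A \<in> SL2_F3" "\<And>u. u \<noteq> 0 \<Longrightarrow> k (Suc (line_of \<psi> u)) = Suc (line_of \<psi> (A *v u))"
    using SL2_F3_realizes_even[OF line_numbering_line_of assms] by auto
  obtain h where h: "h \<in> G0_tilde \<psi>" "\<And>u. u \<noteq> 0 \<Longrightarrow> h (\<psi> u) = \<psi> (A *v u)"
    using SL2_F3_acts[OF A(1)] by blast
  have "h (RChild a) = RChild (k (Suc a) - 1)" if a: "a < 4" for a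
  proof -
    obtain u where u: "u \<noteq> 0" "line_of \<psi> u = a"
      using \<psi>_surj[OF a, of 0] by auto
    then show ?thesis
      using G0_tilde_line[of h u "A *v u"] h SL2_F3_nonzero[OF A(1) u(1)] A(2)[OF u(1)]
      by (simp add: G0_tilde_def)
  qed
  with h(1) show ?thesis by blast
qed

lemma G0_tilde_transitive:
  assumes "a < 4" "b < 2" "a' < 4" "b' < 2"
  shows "\<exists>h\<in>G0_tilde \<psi>. h (RLeaf a b) = RLeaf a' b'"
proof -
  obtain u where u: "u \<noteq> 0" "\<psi> u = RLeaf a b"
    using \<psi>_surj[OF assms(1,2)] by blast
  obtain w where w: "w \<noteq> 0" "\<psi> w = RLeaf a' b'"
    using \<psi>_surj[OF assms(3,4)] by blast
  obtain A where A: "A \<in> SL2_F3" "A *v u = w"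
    using SL2_F3_transitive[OF u(1) w(1)] by blast
  obtain h where "h \<in> G0_tilde \<psi>" "h (\<psi> u) = \<psi> (A *v u)"
    using SL2_F3_acts[OF A(1)] u(1) by blast
  then show ?thesis
    using u w A by (intro bexI[of _ h]) simp_all
qed

text \<open>The only involution in the special linear group is \<open>-1\<close>, which fixes every line.\<close>

lemma G0_tilde_involution:
  assumes h: "h \<in> G0_tilde \<psi>" and hh: "h \<circ> h = id" and a: "a < 4"
  shows "h (RChild a) = RChild a"
proof -
  obtain A where A: "A \<in> SL2_F3" "\<And>u. u \<noteq> 0 \<Longrightarrow> h (\<psi> u) = \<psi> (A *v u)" and haut: "h \<in> rt_aut 4 3"
    using h by (auto simp: G0_tilde_def)
  note nz = SL2_F3_nonzero[OF A(1)]
  have inv: "A *v (A *v u) = u" if "u \<noteq> 0" for u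
    using fun_cong[OF hh, of "\<psi> u"] A(2)[OF that] A(2)[OF nz[OF that]] \<psi>_inj nz that by simp
  obtain u where u: "u \<noteq> 0" "line_of \<psi> u = a"
    using \<psi>_surj[OF a, of 0] by auto
  have "line_of \<psi> (A *v u) = a"
    using SL2_F3_involution[OF A(1) inv u(1)] line_of_eq_iff[OF u(1) nz[OF u(1)]] u(2) by simp
  then show ?thesis
    using G0_tilde_line[OF haut u(1) nz[OF u(1)] A(2)[OF u(1)]] u(2) by simp
qed

end

section \<open>The group of a single rooted ball\<close>

locale lifted_group =
  fixes e :: nat and \<psi> :: "F3_plane \<Rightarrow> rvertex" and j j0 :: "rvertex \<Rightarrow> nat" and \<alpha> :: "rvertex \<Rightarrow> rvertex"
  assumes e: "e \<ge> 3"
    and \<psi>: "admissible_labelling \<psi>"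
    and j: "rt_legal_coloring 4 e j"
    and j0: "rt_legal_coloring 4 3 j0"
    and \<alpha>: "color_matching e j j0 \<alpha>"
begin

lemma \<alpha>_root: "\<alpha> RRoot = RRoot"
  using \<alpha> by (simp add: color_matching_def)

lemma \<alpha>_bij: "bij_betw \<alpha> (rt_children 4) (rt_children 4)"
proof -
  have "bij_betw \<alpha> (insert RRoot (rt_children 4)) (insert RRoot (rt_children 4))"
    using \<alpha> by (simp only: color_matching_def rt_gball_root)
  then have "bij_betw \<alpha> (insert RRoot (rt_children 4) - {RRoot}) (insert RRoot (rt_children 4) - {RRoot})"
    by (rule bij_betw_DiffI) (auto simp: bij_betw_def \<alpha>_root)
  then show ?thesis by simp
qed

lemma \<alpha>_index: "\<exists>\<kappa>. \<kappa> permutes {..<4} \<and> (\<forall>a<4. \<alpha> (RChild a) = RChild (\<kappa> a))"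
  by (rule rt_children_bij_index[OF \<alpha>_bij])

text \<open>The graph of the map f: the property singled out in \<open>f_map\<close>, without the
  condition at the root, which holds anyway because automorphisms and \<open>\<alpha>\<close> fix
  the root.\<close>

definition f_rel :: "(rvertex \<Rightarrow> rvertex) \<Rightarrow> (rvertex \<Rightarrow> rvertex) \<Rightarrow> bool" where
  "f_rel g h \<longleftrightarrow> h \<in> rt_aut 4 3 \<and>
     (\<forall>x\<in>rt_children 4. h (\<alpha> x) = \<alpha> (g x) \<and> (rt_even 4 3 j0 h (\<alpha> x) \<longleftrightarrow> rt_even 4 e j g x))"

lemma f_rel_unique:
  assumes "f_rel g h" "f_rel g h'"
  shows "h = h'"
proof -
  have surj: "\<exists>x\<in>rt_children 4. RChild a = \<alpha> x" if "a < 4" for a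
  proof -
    have "RChild a \<in> \<alpha> ` rt_children 4"
      using bij_betw_imp_surj_on[OF \<alpha>_bij] that by simp
    then show ?thesis by blast
  qed
  show ?thesis
  proof (rule rt_aut_3_eqI[OF j0])
    fix a :: nat assume "a < 4"
    then obtain x where "x \<in> rt_children 4" "RChild a = \<alpha> x" using surj by blast
    then show "h (RChild a) = h' (RChild a)" "rt_even 4 3 j0 h (RChild a) \<longleftrightarrow> rt_even 4 3 j0 h' (RChild a)"
      using assms by (simp_all add: f_rel_def)
  qed (use assms in \<open>simp_all add: f_rel_def\<close>)
qed

text \<open>Conjugation by \<open>\<kappa>\<close>, the action of \<open>\<alpha>\<close> on
  indices, gives the permutation of the children; flips then install the required parities.\<close>

lemma f_rel_exists:
  assumes g: "g \<in> rt_aut 4 e"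
  shows "\<exists>h. f_rel g h"
proof -
  obtain \<pi> where \<pi>: "\<pi> permutes {..<4}" "\<And>a. a < 4 \<Longrightarrow> g (RChild a) = RChild (\<pi> a)"
    using rt_aut_index[OF g] by blast
  obtain \<kappa> where \<kappa>: "\<kappa> permutes {..<4}" "\<And>a. a < 4 \<Longrightarrow> \<alpha> (RChild a) = RChild (\<kappa> a)"
    using \<alpha>_index by blast
  have \<kappa>_lt: "\<kappa> a < 4 \<longleftrightarrow> a < 4" "\<pi> a < 4 \<longleftrightarrow> a < 4" for a
    using permutes_in_image[OF \<kappa>(1), of a] permutes_in_image[OF \<pi>(1), of a] by simp_all
  have \<kappa>_inv: "inv' \<kappa> (\<kappa> a) = a" for a
    by (rule permutes_inverses(2)[OF \<kappa>(1)])
  have perm: "\<kappa> \<circ> (\<pi> \<circ> inv' \<kappa>) permutes {..<4}"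
    by (intro permutes_compose \<kappa>(1) \<pi>(1) permutes_inv)
  obtain h0 where h0: "h0 \<in> rt_aut 4 3" "\<And>a. a < 4 \<Longrightarrow> h0 (RChild a) = RChild (\<kappa> (\<pi> (inv' \<kappa> a)))"
    using rt_permute[OF perm, of 3] by auto
  obtain h where h: "h \<in> rt_aut 4 3" "\<And>a. a < 4 \<Longrightarrow> h (RChild a) = h0 (RChild a)"
    "\<And>a. a < 4 \<Longrightarrow> rt_even 4 3 j0 h (RChild a) \<longleftrightarrow> rt_even 4 e j g (RChild (inv' \<kappa> a))"
    using rt_aut_adjust_parity[OF j0 _ h0(1), of "\<lambda>a. rt_even 4 e j g (RChild (inv' \<kappa> a))"] by auto
  have "f_rel g h"
    unfolding f_rel_def
  proof (intro conjI ballI h(1))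
    fix x assume "x \<in> rt_children 4"
    then obtain a where a: "a < 4" "x = RChild a" by (auto simp: rt_children_def)
    then have "\<kappa> a < 4" using \<kappa>_lt by simp
    show "h (\<alpha> x) = \<alpha> (g x)"
      using a h(2)[OF \<open>\<kappa> a < 4\<close>] h0(2)[OF \<open>\<kappa> a < 4\<close>] \<kappa>(2) \<pi>(2) \<kappa>_lt \<kappa>_inv by simp
    show "rt_even 4 3 j0 h (\<alpha> x) \<longleftrightarrow> rt_even 4 e j g x"
      using a h(3)[OF \<open>\<kappa> a < 4\<close>] \<kappa>(2) \<kappa>_inv by simp
  qed
  then show ?thesis by blast
qed

lemma f_map_eq_The:
  assumes "g \<in> rt_aut 4 e"
  shows "f_map e j j0 \<alpha> g = (THE h. f_rel g h)"
proof -
  have "(h \<in> rt_aut 4 3 \<and> (\<forall>x\<in>gball (rt_edges 4 e) RRoot 1. h (\<alpha> x) = \<alpha> (g x)) \<and>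
     (\<forall>x\<in>gsphere (rt_edges 4 e) RRoot 1. rt_even 4 3 j0 h (\<alpha> x) \<longleftrightarrow> rt_even 4 e j g x)) \<longleftrightarrow> f_rel g h" for h
    unfolding rt_gball_root rt_gsphere_root f_rel_def
    using rt_aut_root[OF assms] rt_aut_root[of h 4 3] \<alpha>_root by auto
  then show ?thesis by (simp only: f_map_def)
qed

lemma f_rel_f_map:
  assumes "g \<in> rt_aut 4 e"
  shows "f_rel g (f_map e j j0 \<alpha> g)"
proof -
  obtain h where h: "f_rel g h" using f_rel_exists[OF assms] by blast
  then have "(THE h. f_rel g h) = h"
    using f_rel_unique by (intro the_equality)
  then show ?thesis using f_map_eq_The[OF assms] h by simp
qed

lemma f_map_eqI: "g \<in> rt_aut 4 e \<Longrightarrow> f_rel g h \<Longrightarrow> f_map e j j0 \<alpha> g = h"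
  by (rule f_rel_unique[OF f_rel_f_map])

abbreviation Gt :: "(rvertex \<Rightarrow> rvertex) set" where
  "Gt \<equiv> G_tilde e \<psi> j j0 \<alpha>"

lemma Gt_aut: "\<gamma> \<in> Gt \<Longrightarrow> \<gamma> \<in> rt_aut 4 e"
  by (simp add: G_tilde_def)

text \<open>Membership in \<open>Gt\<close> depends only on the action on the children and on the
  parities there. The former is right for \<open>\<gamma>0\<close> by assumption, the latter can be
  corrected, and where they already fit the leaves keep their images.\<close>

lemma Gt_lift:
  assumes \<gamma>0: "\<gamma>0 \<in> rt_aut 4 e" and h: "h \<in> G0_tilde \<psi>"
    and eq: "\<And>x. x \<in> rt_children 4 \<Longrightarrow> \<alpha> (\<gamma>0 x) = h (\<alpha> x)"
  shows "\<exists>\<gamma>\<in>Gt. \<forall>a<4. \<gamma> (RChild a) = \<gamma>0 (RChild a) \<and>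
    ((rt_even 4 e j \<gamma>0 (RChild a) \<longleftrightarrow> rt_even 4 3 j0 h (\<alpha> (RChild a))) \<longrightarrow>
      (\<forall>b<e - 1. \<gamma> (RLeaf a b) = \<gamma>0 (RLeaf a b)))"
proof -
  obtain \<gamma> where \<gamma>: "\<gamma> \<in> rt_aut 4 e"
    "\<And>a. a < 4 \<Longrightarrow> \<gamma> (RChild a) = \<gamma>0 (RChild a)"
    "\<And>a. a < 4 \<Longrightarrow> rt_even 4 e j \<gamma> (RChild a) \<longleftrightarrow> rt_even 4 3 j0 h (\<alpha> (RChild a))"
    "\<And>a b. a < 4 \<Longrightarrow> (rt_even 4 e j \<gamma>0 (RChild a) \<longleftrightarrow> rt_even 4 3 j0 h (\<alpha> (RChild a))) \<Longrightarrow>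
      b < e - 1 \<Longrightarrow> \<gamma> (RLeaf a b) = \<gamma>0 (RLeaf a b)"
    using rt_aut_adjust_parity[OF j e \<gamma>0, of "\<lambda>a. rt_even 4 3 j0 h (\<alpha> (RChild a))"] by blast
  have "f_rel \<gamma> h"
    using h eq \<gamma> by (auto simp: f_rel_def G0_tilde_def rt_children_def)
  then have "\<gamma> \<in> Gt"
    using f_map_eqI[OF \<gamma>(1)] h \<gamma>(1) by (simp add: G_tilde_def)
  then show ?thesis
    using \<gamma> by (intro bexI[of _ \<gamma>]) auto
qed

lemma Gt_realizes_children:
  assumes h: "h \<in> G0_tilde \<psi>"
  shows "\<exists>\<gamma>\<in>Gt. \<forall>x\<in>rt_children 4. \<alpha> (\<gamma> x) = h (\<alpha> x)"
proof -
  have haut: "h \<in> rt_aut 4 3" using h by (simp add: G0_tilde_def)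
  let ?\<beta> = "inv_into (rt_children 4) \<alpha>"
  have bij: "bij_betw (?\<beta> \<circ> (h \<circ> \<alpha>)) (rt_children 4) (rt_children 4)"
    by (intro bij_betw_trans[OF bij_betw_trans[OF \<alpha>_bij rt_aut_bij_children[OF haut]]] bij_betw_inv_into \<alpha>_bij)
  obtain \<pi> where \<pi>: "\<pi> permutes {..<4}" "\<And>a. a < 4 \<Longrightarrow> ?\<beta> (h (\<alpha> (RChild a))) = RChild (\<pi> a)"
    using rt_children_bij_index[OF bij] by auto
  obtain \<gamma>0 where \<gamma>0: "\<gamma>0 \<in> rt_aut 4 e" "\<And>a. a < 4 \<Longrightarrow> \<gamma>0 (RChild a) = RChild (\<pi> a)"
    using rt_permute[OF \<pi>(1)] by blast
  have eq: "\<alpha> (\<gamma>0 x) = h (\<alpha> x)" if "x \<in> rt_children 4" for x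
  proof -
    have "h (\<alpha> x) \<in> \<alpha> ` rt_children 4"
      using that bij_betw_imp_surj_on[OF \<alpha>_bij] rt_aut_child_in[OF haut] by blast
    then show ?thesis
      using that \<gamma>0(2) f_inv_into_f[of "h (\<alpha> x)" \<alpha>] by (auto simp: rt_children_def simp flip: \<pi>(2))
  qed
  obtain \<gamma> where \<gamma>: "\<gamma> \<in> Gt" "\<And>a. a < 4 \<Longrightarrow> \<gamma> (RChild a) = \<gamma>0 (RChild a)"
    using Gt_lift[OF \<gamma>0(1) h eq] by blast
  then have "\<alpha> (\<gamma> x) = h (\<alpha> x)" if "x \<in> rt_children 4" for x
    using that eq[OF that] by (auto simp: rt_children_def)
  with \<gamma>(1) show ?thesis by blast
qed

text \<open>Of the prescribed bijection \<open>t\<close>, the map f sees only the pair of children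
  and one parity. In the tree with eight leaves these data amount to one of the two bijections
  between the leaf pairs below \<open>\<kappa> c\<close> and \<open>\<kappa> c'\<close>. Such a
  bijection is determined by the image of a single leaf, so transitivity on nonzero vectors supplies
  a suitable element of \<open>G0_tilde\<close>.\<close>

lemma Gt_extend_star:
  assumes c: "c < 4" "c' < 4"
    and t: "bij_betw t (insert RRoot (rt_leaves_at e c)) (insert RRoot (rt_leaves_at e c'))" "t RRoot = RRoot"
  shows "\<exists>\<gamma>\<in>Gt. \<gamma> (RChild c) = RChild c' \<and> (\<forall>z\<in>insert RRoot (rt_leaves_at e c). \<gamma> z = t z)"
proof -
  obtain \<kappa> where \<kappa>: "\<kappa> permutes {..<4}" "\<And>a. a < 4 \<Longrightarrow> \<alpha> (RChild a) = RChild (\<kappa> a)"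
    using \<alpha>_index by blast
  have \<kappa>_lt: "\<kappa> a < 4 \<longleftrightarrow> a < 4" for a
    using permutes_in_image[OF \<kappa>(1), of a] by simp
  have t': "bij_betw t (rt_leaves_at e c) (rt_leaves_at e c')"
  proof -
    have "bij_betw t (insert RRoot (rt_leaves_at e c) - {RRoot}) (insert RRoot (rt_leaves_at e c') - {RRoot})"
      using t(1) by (rule bij_betw_DiffI) (auto simp: bij_betw_def t(2))
    then show ?thesis by simp
  qed
  have perm: "Transposition.transpose (\<kappa> c) (\<kappa> c') permutes {..<4}"
    using c \<kappa>_lt by (intro permutes_swap_id) auto
  \<comment> \<open>The automorphism \<open>\<eta>\<close> built from \<open>\<eta>0\<close> need
    not lie in \<open>G0_tilde\<close>. It is a template that turns the parity of \<open>t\<close>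
    into a concrete image of one leaf.\<close>
  obtain \<eta>0 where \<eta>0: "\<eta>0 \<in> rt_aut 4 3" "\<eta>0 (RChild (\<kappa> c)) = RChild (\<kappa> c')"
    using rt_permute[OF perm, of 3] c \<kappa>_lt by auto
  obtain \<eta> where \<eta>: "\<eta> \<in> rt_aut 4 3" "\<eta> (RChild (\<kappa> c)) = RChild (\<kappa> c')"
    "rt_even 4 3 j0 \<eta> (RChild (\<kappa> c)) \<longleftrightarrow> rt_even 4 e j t (RChild c)"
    using rt_aut_adjust_parity[OF j0 _ \<eta>0(1), of "\<lambda>_. rt_even 4 e j t (RChild c)"] \<eta>0(2) c \<kappa>_lt by auto
  obtain b' where b': "b' < 2" "\<eta> (RLeaf (\<kappa> c) 0) = RLeaf (\<kappa> c') b'"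
    using rt_aut_leaf[OF \<eta>(1) _ \<eta>(2), of 0] c \<kappa>_lt by auto
  \<comment> \<open>Agreement with \<open>\<eta>\<close> at one leaf below \<open>\<kappa> c\<close>
    forces agreement at the other, and with it the same parity.\<close>
  obtain h where h: "h \<in> G0_tilde \<psi>" "h (RLeaf (\<kappa> c) 0) = RLeaf (\<kappa> c') b'"
    using G0_tilde_transitive[OF \<psi>, of "\<kappa> c" 0 "\<kappa> c'" b'] b'(1) c \<kappa>_lt by auto
  have haut: "h \<in> rt_aut 4 3" using h(1) by (simp add: G0_tilde_def)
  obtain \<rho> where \<rho>: "\<And>a. a < 4 \<Longrightarrow> h (RChild a) = RChild (\<rho> a)"
    using rt_aut_index[OF haut] by blast
  have hc: "h (RChild (\<kappa> c)) = RChild (\<kappa> c')"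
    using rt_aut_leaf[OF haut _ \<rho>, of "\<kappa> c" 0] h(2) \<rho>[of "\<kappa> c"] c \<kappa>_lt by auto
  have L: "rt_leaves_at 3 a = {RLeaf a 0, RLeaf a 1}" for a
    by (auto simp: rt_leaves_at_def)
  have agree: "h (RLeaf (\<kappa> c) 1) = \<eta> (RLeaf (\<kappa> c) 1)"
  proof -
    have "bij_betw g {RLeaf (\<kappa> c) 0, RLeaf (\<kappa> c) 1} {RLeaf (\<kappa> c') 0, RLeaf (\<kappa> c') 1}"
      if "g \<in> rt_aut 4 3" "g (RChild (\<kappa> c)) = RChild (\<kappa> c')" for g
      using rt_aut_bij_leaves_at[OF that(1) _ that(2)] c \<kappa>_lt by (simp add: L)
    from this[OF haut hc] this[OF \<eta>(1,2)]
    have "{h (RLeaf (\<kappa> c) 0), h (RLeaf (\<kappa> c) 1)} = {\<eta> (RLeaf (\<kappa> c) 0), \<eta> (RLeaf (\<kappa> c) 1)}"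
      by (auto simp: bij_betw_def)
    then show ?thesis
      using h(2) b'(2) by (auto simp: doubleton_eq_iff)
  qed
  have "local_perm (rt_edges 4 3) j0 h (RChild (\<kappa> c)) = local_perm (rt_edges 4 3) j0 \<eta> (RChild (\<kappa> c))"
  proof (rule local_perm_cong)
    fix x assume "x \<in> gsphere (rt_edges 4 3) (RChild (\<kappa> c)) 1"
    then have "x = RRoot \<or> x = RLeaf (\<kappa> c) 0 \<or> x = RLeaf (\<kappa> c) 1"
      using rt_gsphere_child[of "\<kappa> c" 4 3] c(1) \<kappa>_lt L by simp
    then show "h x = \<eta> x"
      using agree h(2) b'(2) rt_aut_root[OF haut] rt_aut_root[OF \<eta>(1)] by auto
  qed
  then have even: "rt_even 4 3 j0 h (\<alpha> (RChild c)) \<longleftrightarrow> rt_even 4 e j t (RChild c)"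
    using \<eta>(3) \<kappa>(2) c by simp
  \<comment> \<open>Only the permutation of the children is taken from \<open>\<gamma>1\<close>;
    \<open>\<gamma>0\<close> combines it with \<open>t\<close> below \<open>c\<close>. The final
    correction of parities leaves the star of \<open>RChild c\<close> alone because the parity there
    already fits.\<close>
  obtain \<gamma>1 where \<gamma>1: "\<gamma>1 \<in> Gt" "\<And>x. x \<in> rt_children 4 \<Longrightarrow> \<alpha> (\<gamma>1 x) = h (\<alpha> x)"
    using Gt_realizes_children[OF h(1)] by blast
  obtain \<pi> where \<pi>: "\<pi> permutes {..<4}" "\<And>a. a < 4 \<Longrightarrow> \<gamma>1 (RChild a) = RChild (\<pi> a)"
    using rt_aut_index[OF Gt_aut[OF \<gamma>1(1)]] by blast
  have "\<alpha> (RChild (\<pi> c)) = \<alpha> (RChild c')"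
    using \<gamma>1(2)[of "RChild c"] \<pi>(2) hc \<kappa>(2) c by simp
  then have \<pi>c: "\<pi> c = c'"
    using inj_onD[OF bij_betw_imp_inj_on[OF \<alpha>_bij], of "RChild (\<pi> c)" "RChild c'"]
      permutes_in_image[OF \<pi>(1), of c] c by simp
  obtain \<gamma>0 where \<gamma>0: "\<gamma>0 \<in> rt_aut 4 e" "\<And>a. a < 4 \<Longrightarrow> \<gamma>0 (RChild a) = RChild (\<pi> a)"
    "\<And>b. b < e - 1 \<Longrightarrow> \<gamma>0 (RLeaf c b) = t (RLeaf c b)"
    using rt_permute_star[OF \<pi>(1) c(1), of t e] t' \<pi>c by auto
  have eq: "\<alpha> (\<gamma>0 x) = h (\<alpha> x)" if "x \<in> rt_children 4" for x
    using that \<gamma>1(2)[OF that] \<gamma>0(2) \<pi>(2) by (auto simp: rt_children_def)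
  have \<gamma>0_star: "\<gamma>0 z = t z" if "z \<in> insert RRoot (rt_leaves_at e c)" for z
    using that \<gamma>0(3) rt_aut_root[OF \<gamma>0(1)] t(2) by (auto simp: rt_leaves_at_def)
  have "local_perm (rt_edges 4 e) j \<gamma>0 (RChild c) = local_perm (rt_edges 4 e) j t (RChild c)"
    by (rule local_perm_cong) (use \<gamma>0_star c in \<open>simp only: rt_gsphere_child\<close>)
  then have "\<exists>\<gamma>\<in>Gt. \<gamma> (RChild c) = \<gamma>0 (RChild c) \<and> (\<forall>b<e - 1. \<gamma> (RLeaf c b) = \<gamma>0 (RLeaf c b))"
    using Gt_lift[OF \<gamma>0(1) h(1) eq] even c(1) by metis
  then obtain \<gamma> where \<gamma>: "\<gamma> \<in> Gt" "\<gamma> (RChild c) = RChild c'" "\<And>b. b < e - 1 \<Longrightarrow> \<gamma> (RLeaf c b) = t (RLeaf c b)"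
    using \<gamma>0(2)[OF c(1)] \<gamma>0(3) \<pi>c by auto
  then show ?thesis
    using rt_aut_root[OF Gt_aut[OF \<gamma>(1)]] t(2) by (intro bexI[of _ \<gamma>]) (auto simp: rt_leaves_at_def)
qed

lemma Gt_even:
  assumes \<gamma>: "\<gamma> \<in> Gt" and k: "k permutes {1..4}"
    and \<gamma>k: "\<And>x a. x \<in> rt_children 4 \<Longrightarrow> \<alpha> x = RChild a \<Longrightarrow> \<alpha> (\<gamma> x) = RChild (k (Suc a) - 1)"
  shows "evenperm k"
proof (rule G0_tilde_even[OF \<psi>])
  show "f_map e j j0 \<alpha> \<gamma> \<in> G0_tilde \<psi>" using \<gamma> by (simp add: G_tilde_def)
  fix a :: nat assume "a < 4"
  then have "RChild a \<in> \<alpha> ` rt_children 4"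
    using bij_betw_imp_surj_on[OF \<alpha>_bij] by simp
  then obtain x where "x \<in> rt_children 4" "RChild a = \<alpha> x" by blast
  then have x: "x \<in> rt_children 4" "\<alpha> x = RChild a" by simp_all
  then show "f_map e j j0 \<alpha> \<gamma> (RChild a) = RChild (k (Suc a) - 1)"
    using f_rel_f_map[OF Gt_aut[OF \<gamma>]] \<gamma>k[OF x] by (auto simp: f_rel_def)
qed (rule k)

lemma Gt_realizes_even:
  assumes "k permutes {1..4}" "evenperm k"
  shows "\<exists>\<gamma>\<in>Gt. \<forall>x\<in>rt_children 4. \<forall>a. \<alpha> x = RChild a \<longrightarrow> \<alpha> (\<gamma> x) = RChild (k (Suc a) - 1)"
proof -
  obtain h where h: "h \<in> G0_tilde \<psi>" "\<And>a. a < 4 \<Longrightarrow> h (RChild a) = RChild (k (Suc a) - 1)"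
    using G0_tilde_realizes_even[OF \<psi> assms] by blast
  obtain \<gamma> where \<gamma>: "\<gamma> \<in> Gt" "\<And>x. x \<in> rt_children 4 \<Longrightarrow> \<alpha> (\<gamma> x) = h (\<alpha> x)"
    using Gt_realizes_children[OF h(1)] by blast
  have "\<alpha> (\<gamma> x) = RChild (k (Suc a) - 1)" if "x \<in> rt_children 4" "\<alpha> x = RChild a" for x a
  proof -
    have "RChild a \<in> rt_children 4"
      using bij_betwE[OF \<alpha>_bij] that(1) unfolding that(2)[symmetric] by blast
    then show ?thesis using \<gamma>(2)[OF that(1)] that(2) h(2)[of a] by simp
  qed
  with \<gamma>(1) show ?thesis by blast
qed

text \<open>The action on the children and the parities compose by the same rules in both rooted
  trees, so the image \<open>h\<close> under f again has trivial square, and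
  \<open>G0_tilde_involution\<close> applies to it.\<close>

lemma Gt_involution:
  assumes \<gamma>: "\<gamma> \<in> Gt" and \<gamma>\<gamma>: "\<gamma> \<circ> \<gamma> = id" and x: "x \<in> rt_children 4"
  shows "\<gamma> x = x"
proof -
  note \<gamma>aut = Gt_aut[OF \<gamma>]
  define h where "h = f_map e j j0 \<alpha> \<gamma>"
  have h: "h \<in> G0_tilde \<psi>" "h \<in> rt_aut 4 3"
    and h\<alpha>: "\<And>x. x \<in> rt_children 4 \<Longrightarrow> h (\<alpha> x) = \<alpha> (\<gamma> x)"
    and heven: "\<And>x. x \<in> rt_children 4 \<Longrightarrow> rt_even 4 3 j0 h (\<alpha> x) \<longleftrightarrow> rt_even 4 e j \<gamma> x"
    using \<gamma> f_rel_f_map[OF \<gamma>aut] by (auto simp: h_def G_tilde_def f_rel_def)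
  have \<gamma>x: "\<gamma> x \<in> rt_children 4" if "x \<in> rt_children 4" for x
    by (rule rt_aut_child_in[OF \<gamma>aut that])
  have \<alpha>x: "\<alpha> x \<in> rt_children 4" if "x \<in> rt_children 4" for x
    using bij_betwE[OF \<alpha>_bij] that by blast
  have surj: "\<exists>x\<in>rt_children 4. RChild a = \<alpha> x" if "a < 4" for a
  proof -
    have "RChild a \<in> \<alpha> ` rt_children 4"
      using bij_betw_imp_surj_on[OF \<alpha>_bij] that by simp
    then show ?thesis by blast
  qed
  have "h \<circ> h = id"
  proof (rule rt_aut_3_eqI[OF j0 rt_aut_comp[OF h(2) h(2)] rt_aut_id])
    fix a :: nat assume "a < 4"
    then obtain x where x: "x \<in> rt_children 4" "RChild a = \<alpha> x" using surj by blast
    show "(h \<circ> h) (RChild a) = id (RChild a)"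
      using x h\<alpha>[OF x(1)] h\<alpha>[OF \<gamma>x[OF x(1)]] fun_cong[OF \<gamma>\<gamma>, of x] by simp
    \<comment> \<open>By the cocycle rule the parities at \<open>x\<close> and at
      \<open>\<gamma> x\<close> combine to that of the identity, so they coincide.\<close>
    have "rt_even 4 e j \<gamma> (\<gamma> x) \<longleftrightarrow> rt_even 4 e j \<gamma> x"
      using rt_even_comp[OF j \<gamma>aut \<gamma>aut x(1)] rt_even_id[OF j x(1)] \<gamma>\<gamma> by simp
    then have "rt_even 4 3 j0 h (h (\<alpha> x)) \<longleftrightarrow> rt_even 4 3 j0 h (\<alpha> x)"
      using heven[OF x(1)] heven[OF \<gamma>x[OF x(1)]] h\<alpha>[OF x(1)] by simp
    then show "rt_even 4 3 j0 (h \<circ> h) (RChild a) \<longleftrightarrow> rt_even 4 3 j0 id (RChild a)"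
      using rt_even_comp[OF j0 h(2) h(2) \<alpha>x[OF x(1)]] rt_even_id[OF j0 \<alpha>x[OF x(1)]] x(2) by simp
  qed
  then have "h (\<alpha> x) = \<alpha> x"
    using G0_tilde_involution[OF \<psi> h(1)] \<alpha>x[OF x] by (auto simp: rt_children_def)
  then show ?thesis
    using h\<alpha>[OF x] inj_onD[OF bij_betw_imp_inj_on[OF \<alpha>_bij] _ \<gamma>x[OF x] x] by simp
qed

end

lemma bij_betw_card_eqI:
  assumes "inj_on f A" "f ` A \<subseteq> B" "finite B" "card A = card B"
  shows "bij_betw f A B"
  using assms card_subset_eq[of B "f ` A"] by (simp add: bij_betw_def card_image)

text \<open>An edge at \<open>x\<close> is determined by its other end, so a labelling of the
  neighbours induces one of the incident edges, and the action on edges can be computed on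
  neighbours.\<close>

lemma perm_isomorphic_local_action:
  assumes x: "(x, x) \<notin> E" and lab: "bij_betw lab (E `` {x}) Y"
    and G: "\<And>g. g \<in> G \<Longrightarrow> g x = x \<Longrightarrow> g ` (E `` {x}) \<subseteq> E `` {x}"
    and K: "\<And>k. k \<in> K \<longleftrightarrow> k permutes Y \<and> (\<exists>g\<in>G. g x = x \<and> (\<forall>y\<in>E `` {x}. k (lab y) = lab (g y)))"
  shows "perm_isomorphic (incident_edges E x) (local_action E G x) Y K"
proof -
  let ?N = "E `` {x}" and ?e = "\<lambda>y. {x, y}"
  have e: "bij_betw ?e ?N (incident_edges E x)"
    using x by (auto simp: bij_betw_def inj_on_def doubleton_eq_iff incident_edges_def)
  define \<phi> where "\<phi> = lab \<circ> inv_into ?N ?e"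
  have \<phi>: "\<phi> {x, y} = lab y" if "y \<in> ?N" for y
    using inv_into_f_f[OF bij_betw_imp_inj_on[OF e] that] by (simp add: \<phi>_def)
  have bij: "bij_betw \<phi> (incident_edges E x) Y"
    unfolding \<phi>_def by (rule bij_betw_trans[OF bij_betw_inv_into[OF e] lab])
  have edges: "(\<forall>d\<in>incident_edges E x. P d) \<longleftrightarrow> (\<forall>y\<in>?N. P {x, y})" for P
    by (auto simp: incident_edges_def)
  have act: "perm_restrict ((`) g) (incident_edges E x) {x, y} = {x, g y}" if "g x = x" "y \<in> ?N" for g y
  proof -
    have "{x, y} \<in> incident_edges E x" using that(2) by (auto simp: incident_edges_def)
    then show ?thesis using that(1) by (simp add: perm_restrict_def)
  qed
  have "(\<exists>h\<in>local_action E G x. \<forall>d\<in>incident_edges E x. k (\<phi> d) = \<phi> (h d)) \<longleftrightarrow>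
      (\<exists>g\<in>G. g x = x \<and> (\<forall>y\<in>?N. k (lab y) = lab (g y)))" for k
  proof -
    have "(\<exists>h\<in>local_action E G x. \<forall>d\<in>incident_edges E x. k (\<phi> d) = \<phi> (h d)) \<longleftrightarrow>
      (\<exists>g\<in>G. g x = x \<and> (\<forall>y\<in>?N. k (\<phi> {x, y}) = \<phi> (perm_restrict ((`) g) (incident_edges E x) {x, y})))"
      unfolding edges local_action_def by blast
    also have "\<dots> \<longleftrightarrow> (\<exists>g\<in>G. g x = x \<and> (\<forall>y\<in>?N. k (lab y) = lab (g y)))"
    proof (intro bex_cong refl conj_cong ball_cong)
      fix g y assume g: "g \<in> G" "g x = x" and y: "y \<in> ?N"
      then have "g y \<in> ?N" using G by blast
      then show "k (\<phi> {x, y}) = \<phi> (perm_restrict ((`) g) (incident_edges E x) {x, y}) \<longleftrightarrow> k (lab y) = lab (g y)"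
        using \<phi> y act[of g y] g(2) by simp
    qed
    finally show ?thesis .
  qed
  then have "K = {k. k permutes Y \<and> (\<exists>h\<in>local_action E G x. \<forall>d\<in>incident_edges E x. k (\<phi> d) = \<phi> (h d))}"
    using K by blast
  with bij show ?thesis
    unfolding perm_isomorphic_def by blast
qed

section \<open>The group of the semiregular tree\<close>

locale tree_with_charts = lifted_group d1 \<psi> j j0 \<alpha>
  for d1 :: nat and \<psi> :: "F3_plane \<Rightarrow> rvertex" and j j0 :: "rvertex \<Rightarrow> nat" and \<alpha> :: "rvertex \<Rightarrow> rvertex" +
  fixes V0 V1 :: "'a set" and E :: "'a rel" and J :: "'a \<Rightarrow> 'a \<Rightarrow> rvertex"
  assumes semiregular: "semiregular_tree 4 d1 V0 V1 E"
    and charts: "\<And>x. x \<in> V0 \<Longrightarrow> rooted_ball_iso E 4 d1 x (J x)"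
begin

abbreviation "N v \<equiv> E `` {v}"
abbreviation "Gr \<equiv> G_group d1 V0 V1 E \<psi> j j0 \<alpha> J"

lemma tree: "is_tree (V0 \<union> V1) E"
  using semiregular by (simp add: semiregular_tree_def)

lemma disj: "v \<in> V0 \<Longrightarrow> v \<in> V1 \<Longrightarrow> False"
  using semiregular by (auto simp: semiregular_tree_def)

lemma bip: "(v, w) \<in> E \<Longrightarrow> v \<in> V0 \<and> w \<in> V1 \<or> v \<in> V1 \<and> w \<in> V0"
  using semiregular by (fastforce simp: semiregular_tree_def)

lemma nb0: "v \<in> V0 \<Longrightarrow> (v, w) \<in> E \<Longrightarrow> w \<in> V1"
  and nb1: "v \<in> V1 \<Longrightarrow> (v, w) \<in> E \<Longrightarrow> w \<in> V0"
  using bip disj by blast+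

lemma E_sym: "(v, w) \<in> E \<Longrightarrow> (w, v) \<in> E"
  by (rule is_tree_sym[OF tree])

lemma E_irrefl: "(v, v) \<notin> E"
  by (rule is_tree_irrefl[OF tree])

lemma card_N: "v \<in> V0 \<Longrightarrow> finite (N v) \<and> card (N v) = 4"
    "v \<in> V1 \<Longrightarrow> finite (N v) \<and> card (N v) = d1"
  using semiregular by (simp_all add: semiregular_tree_def)

lemma bij_N_I:
  assumes "v \<in> V0 \<and> u \<in> V0 \<or> v \<in> V1 \<and> u \<in> V1" "inj_on s (N v)" "s ` N v \<subseteq> N u"
  shows "bij_betw s (N v) (N u)"
  using assms card_N by (intro bij_betw_card_eqI) auto

lemma V0_nonempty: "V0 \<noteq> {}"
proof
  assume "V0 = {}"
  then obtain y where y: "y \<in> V1" using tree by (auto simp: is_tree_def)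
  then have "N y \<noteq> {}" using card_N(2)[OF y] e by auto
  then show False using nb1[OF y] \<open>V0 = {}\<close> by blast
qed

lemma local_aut_automorphism:
  assumes g0: "\<And>x. x \<in> V0 \<Longrightarrow> g x \<in> V0" and g1: "\<And>y. y \<in> V1 \<Longrightarrow> g y \<in> V1"
    and out: "\<And>v. v \<notin> V0 \<union> V1 \<Longrightarrow> g v = v"
    and bij: "\<And>v. v \<in> V0 \<union> V1 \<Longrightarrow> bij_betw g (N v) (N (g v))"
  shows "g \<in> aut_plus V0 V1 E"
proof -
  have g: "g \<in> graph_aut (V0 \<union> V1) E"
    by (rule tree_local_iso_automorphism[OF tree _ out bij]) (use g0 g1 in auto)
  then have "g ` V0 \<union> g ` V1 = V0 \<union> V1"
    using permutes_image[of g "V0 \<union> V1"] by (simp add: graph_aut_def image_Un)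
  moreover have "g ` V0 \<subseteq> V0" "g ` V1 \<subseteq> V1"
    using g0 g1 by auto
  moreover have "V0 \<inter> V1 = {}"
    using semiregular by (simp add: semiregular_tree_def)
  ultimately have "g ` V0 = V0 \<and> g ` V1 = V1"
    by blast
  with g show ?thesis by (simp add: aut_plus_def)
qed

lemma aut_plusD:
  assumes "g \<in> aut_plus V0 V1 E"
  shows "v \<in> V0 \<Longrightarrow> g v \<in> V0" "v \<in> V1 \<Longrightarrow> g v \<in> V1"
    and "v \<notin> V0 \<union> V1 \<Longrightarrow> g v = v" "(v, w) \<in> E \<Longrightarrow> (g v, g w) \<in> E"
  using assms is_tree_edge_verts[OF tree, of v w]
  by (auto simp: aut_plus_def graph_aut_def permutes_not_in)

section \<open>Charts, germs and their extension\<close>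

abbreviation "B x \<equiv> gball E x 2"

lemma B_iff: "z \<in> B x \<longleftrightarrow> z = x \<or> (x, z) \<in> E \<or> (\<exists>y. (x, y) \<in> E \<and> (y, z) \<in> E)"
  unfolding gball_2 by auto

lemma J_bij: "x \<in> V0 \<Longrightarrow> bij_betw (J x) (B x) (rt_verts 4 d1)"
  and J_root: "x \<in> V0 \<Longrightarrow> J x x = RRoot"
  and J_edge: "x \<in> V0 \<Longrightarrow> y \<in> B x \<Longrightarrow> z \<in> B x \<Longrightarrow> (J x y, J x z) \<in> rt_edges 4 d1 \<longleftrightarrow> (y, z) \<in> E"
  using charts by (simp_all add: rooted_ball_iso_def)

lemma J_eq_iff: "x \<in> V0 \<Longrightarrow> y \<in> B x \<Longrightarrow> z \<in> B x \<Longrightarrow> J x y = J x z \<longleftrightarrow> y = z"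
  using inj_on_eq_iff[OF bij_betw_imp_inj_on[OF J_bij]] by blast

lemma J_in: "x \<in> V0 \<Longrightarrow> z \<in> B x \<Longrightarrow> J x z \<in> rt_verts 4 d1"
  using bij_betwE[OF J_bij] by blast

lemma J_bij_N:
  assumes x: "x \<in> V0" and y: "y \<in> insert x (N x)"
  shows "bij_betw (J x) (N y) (rt_edges 4 d1 `` {J x y})"
proof -
  have sub: "N y \<subseteq> B x" "y \<in> B x" using y by (auto simp: B_iff)
  have "J x ` N y = rt_edges 4 d1 `` {J x y}"
  proof (intro equalityI subsetI)
    fix c assume c: "c \<in> rt_edges 4 d1 `` {J x y}"
    then have "c \<in> J x ` B x"
      using rt_edges_subset bij_betw_imp_surj_on[OF J_bij[OF x]] by blast
    then show "c \<in> J x ` N y" using c J_edge[OF x sub(2)] by auto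
  qed (use J_edge[OF x sub(2)] sub in blast)
  then show ?thesis
    using inj_on_subset[OF bij_betw_imp_inj_on[OF J_bij[OF x]] sub(1)] by (simp add: bij_betw_def)
qed

lemma J_bij_children: "x \<in> V0 \<Longrightarrow> bij_betw (J x) (N x) (rt_children 4)"
  using J_bij_N[of x x] by (simp add: J_root rt_neighbours_root)

lemma J_child:
  assumes "x \<in> V0" "y \<in> N x"
  shows "\<exists>c<4. J x y = RChild c"
  using bij_betwE[OF J_bij_children[OF assms(1)]] assms(2) by (auto simp: rt_children_def)

lemma J_bij_star:
  assumes "x \<in> V0" "y \<in> N x" "J x y = RChild c" "c < 4"
  shows "bij_betw (J x) (N y) (insert RRoot (rt_leaves_at d1 c))"
  using J_bij_N[of x y] assms by (simp add: rt_neighbours_child)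

text \<open>The germs of elements of the group: on 2-balls around \<open>V0\<close> and on 1-balls around \<open>V1\<close>.\<close>

definition chart_rel :: "'a \<Rightarrow> ('a \<Rightarrow> 'a) \<Rightarrow> (rvertex \<Rightarrow> rvertex) \<Rightarrow> bool" where
  "chart_rel x s \<gamma> \<longleftrightarrow> (\<forall>z\<in>B x. s z \<in> B (s x) \<and> J (s x) (s z) = \<gamma> (J x z))"

definition germ :: "'a \<Rightarrow> ('a \<Rightarrow> 'a) \<Rightarrow> bool" where
  "germ v s \<longleftrightarrow> (v \<in> V0 \<longrightarrow> s v \<in> V0 \<and> (\<exists>\<gamma>\<in>Gt. chart_rel v s \<gamma>)) \<and>
     (v \<in> V1 \<longrightarrow> s v \<in> V1 \<and> bij_betw s (N v) (N (s v)))"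

lemma germ_from_chart:
  assumes x: "x \<in> V0" "x' \<in> V0" and \<gamma>: "\<gamma> \<in> Gt"
  shows "\<exists>s. germ x s \<and> s x = x' \<and> chart_rel x s \<gamma>"
proof -
  define s where "s z = inv_into (B x') (J x') (\<gamma> (J x z))" for z
  have in_im: "\<gamma> (J x z) \<in> J x' ` B x'" if "z \<in> B x" for z
    using J_in[OF x(1) that] permutes_in_image[OF rt_aut_permutes[OF Gt_aut[OF \<gamma>]]]
      bij_betw_imp_surj_on[OF J_bij[OF x(2)]] by simp
  have s: "s z \<in> B x'" "J x' (s z) = \<gamma> (J x z)" if "z \<in> B x" for z
    using inv_into_into[OF in_im[OF that]] f_inv_into_f[OF in_im[OF that]] by (simp_all add: s_def)
  have "x \<in> B x" "x' \<in> B x'" by (simp_all add: B_iff)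
  then have "s x = x'"
    using s[of x] J_eq_iff[OF x(2), of "s x" x'] J_root x rt_aut_root[OF Gt_aut[OF \<gamma>]] by simp
  then have "chart_rel x s \<gamma>" using s by (simp add: chart_rel_def)
  moreover have "germ x s"
    using \<open>s x = x'\<close> \<gamma> x \<open>chart_rel x s \<gamma>\<close> disj by (auto simp: germ_def)
  ultimately show ?thesis using \<open>s x = x'\<close> by blast
qed

lemma chart_rel_bij:
  assumes x: "x \<in> V0" "s x \<in> V0" and \<gamma>: "\<gamma> \<in> Gt" and s: "chart_rel x s \<gamma>" and y: "y \<in> insert x (N x)"
  shows "bij_betw s (N y) (N (s y))" and "y \<in> N x \<Longrightarrow> s y \<in> N (s x)"
proof -
  have \<gamma>_edge: "(\<gamma> a, \<gamma> b) \<in> rt_edges 4 d1 \<longleftrightarrow> (a, b) \<in> rt_edges 4 d1"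
    if "a \<in> rt_verts 4 d1" "b \<in> rt_verts 4 d1" for a b
    using Gt_aut[OF \<gamma>] that by (simp add: rt_aut_def graph_aut_def)
  have edge: "(s a, s b) \<in> E \<longleftrightarrow> (a, b) \<in> E" if "a \<in> B x" "b \<in> B x" for a b
  proof -
    have "(s a, s b) \<in> E \<longleftrightarrow> (J (s x) (s a), J (s x) (s b)) \<in> rt_edges 4 d1"
      using s that by (intro J_edge[OF x(2), symmetric]) (auto simp: chart_rel_def)
    also have "\<dots> \<longleftrightarrow> (J x a, J x b) \<in> rt_edges 4 d1"
      using s that \<gamma>_edge[OF J_in[OF x(1) that(1)] J_in[OF x(1) that(2)]] by (simp add: chart_rel_def)
    also have "\<dots> \<longleftrightarrow> (a, b) \<in> E" using J_edge[OF x(1) that] .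
    finally show ?thesis .
  qed
  have sub: "insert y (N y) \<subseteq> B x" "x \<in> B x" using y by (auto simp: B_iff)
  then show nb: "y \<in> N x \<Longrightarrow> s y \<in> N (s x)"
    using edge[of x y] by auto
  have inj: "inj_on s (B x)"
  proof (rule inj_onI)
    fix a b assume ab: "a \<in> B x" "b \<in> B x" "s a = s b"
    then have "\<gamma> (J x a) = \<gamma> (J x b)" using s by (metis chart_rel_def)
    then have "J x a = J x b"
      using permutes_inj[OF rt_aut_permutes[OF Gt_aut[OF \<gamma>]]] by (simp add: inj_def)
    then show "a = b" using J_eq_iff[OF x(1) ab(1,2)] by simp
  qed
  show "bij_betw s (N y) (N (s y))"
  proof (rule bij_N_I)
    show "y \<in> V0 \<and> s y \<in> V0 \<or> y \<in> V1 \<and> s y \<in> V1"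
      using y x nb nb0[OF x(1)] nb0[OF x(2)] by auto
    show "inj_on s (N y)" using inj sub(1) by (auto intro: inj_on_subset)
    show "s ` N y \<subseteq> N (s y)" using edge sub(1) by auto
  qed
qed

text \<open>Along an edge, the germs have to agree on the star of the end of type 1. The 2-balls
  around two vertices of type 0 with a common neighbour meet exactly in the star of that neighbour,
  so no further condition arises. Both orientations are listed to make the relation
  symmetric.\<close>

definition compatible :: "'a \<Rightarrow> ('a \<Rightarrow> 'a) \<Rightarrow> 'a \<Rightarrow> ('a \<Rightarrow> 'a) \<Rightarrow> bool" where
  "compatible v s w t \<longleftrightarrow> (v \<in> V1 \<longrightarrow> (\<forall>z\<in>insert v (N v). s z = t z)) \<and>
     (w \<in> V1 \<longrightarrow> (\<forall>z\<in>insert w (N w). s z = t z))"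

lemma germ_extend:
  assumes vw: "(v, w) \<in> E" and s: "germ v s"
  shows "\<exists>t. germ w t \<and> compatible v s w t"
proof (cases "v \<in> V0")
  case True
  then have w: "w \<in> V1" "w \<notin> V0" using nb0 vw disj by blast+
  obtain \<gamma> where \<gamma>: "\<gamma> \<in> Gt" "s v \<in> V0" "chart_rel v s \<gamma>"
    using s True by (auto simp: germ_def)
  have "s w \<in> N (s v)" "bij_betw s (N w) (N (s w))"
    using chart_rel_bij[OF True \<gamma>(2,1,3), of w] vw by auto
  \<comment> \<open>From type 0 to type 1 a germ only has to be restricted, so \<open>s\<close>
    itself serves at \<open>w\<close>.\<close>
  then have "germ w s" using w nb0[OF \<gamma>(2)] by (auto simp: germ_def)
  then show ?thesis by (auto simp: compatible_def)
next
  case False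
  then have v: "v \<in> V1" and w: "w \<in> V0" using bip[OF vw] by auto
  have sv: "s v \<in> V1" and s_bij: "bij_betw s (N v) (N (s v))"
    using s v by (auto simp: germ_def)
  have "s w \<in> N (s v)" using bij_betwE[OF s_bij] vw by blast
  then have sw: "s w \<in> V0" "s v \<in> N (s w)" using nb1[OF sv] E_sym by auto
  have vNw: "v \<in> N w" using E_sym[OF vw] by simp
  obtain c where c: "c < 4" "J w v = RChild c" using J_child[OF w vNw] by blast
  obtain c' where c': "c' < 4" "J (s w) (s v) = RChild c'" using J_child[OF sw] by blast
  have Jw: "bij_betw (J w) (N v) (insert RRoot (rt_leaves_at d1 c))"
    by (rule J_bij_star[OF w vNw c(2,1)])
  \<comment> \<open>The star of \<open>v\<close> seen in the charts at \<open>w\<close> and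
    \<open>s w\<close>. Both charts send the centre of the ball to the root, so \<open>T\<close>
    fixes the root and is of the form that \<open>Gt_extend_star\<close> extends.\<close>
  define T where "T = J (s w) \<circ> s \<circ> inv_into (N v) (J w)"
  have T: "T (J w z) = J (s w) (s z)" if "z \<in> N v" for z
    using inv_into_f_f[OF bij_betw_imp_inj_on[OF Jw] that] by (simp add: T_def)
  have "bij_betw T (insert RRoot (rt_leaves_at d1 c)) (insert RRoot (rt_leaves_at d1 c'))"
    unfolding T_def
    by (intro bij_betw_trans[OF bij_betw_inv_into[OF Jw]] bij_betw_trans[OF s_bij] J_bij_star sw c')
  moreover have "T RRoot = RRoot"
    using T[of w] vw J_root w sw(1) by simp
  ultimately obtain \<gamma> where \<gamma>: "\<gamma> \<in> Gt" "\<gamma> (RChild c) = RChild c'"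
    "\<And>z. z \<in> insert RRoot (rt_leaves_at d1 c) \<Longrightarrow> \<gamma> z = T z"
    using Gt_extend_star[OF c(1) c'(1)] by blast
  obtain t where t: "germ w t" "t w = s w" "chart_rel w t \<gamma>"
    using germ_from_chart[OF w sw(1) \<gamma>(1)] by blast
  have "t z = s z" if z: "z \<in> insert v (N v)" for z
  proof -
    have zB: "z \<in> B w" "s z \<in> B (s w)"
      using z vNw sw(2) bij_betwE[OF s_bij] by (auto simp: B_iff)
    have "\<gamma> (J w z) = J (s w) (s z)"
      using z c(2) c'(2) \<gamma>(2) \<gamma>(3)[of "J w z"] T[of z] bij_betwE[OF Jw] by auto
    moreover have "t z \<in> B (s w)" "J (s w) (t z) = \<gamma> (J w z)"
      using t(2,3) zB(1) by (auto simp: chart_rel_def)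
    ultimately show ?thesis using J_eq_iff[OF sw(1), of "t z" "s z"] zB(2) by simp
  qed
  then have "compatible v s w t" using w disj by (auto simp: compatible_def)
  with t(1) show ?thesis by blast
qed

text \<open>\<open>tree_choice\<close> selects compatible germs at all vertices. The map that takes
  from each germ only its value at the centre agrees with that germ on its whole ball, so it is
  locally bijective and lies in the group.\<close>

lemma G_group_extend:
  assumes r: "r \<in> V0 \<union> V1" and s0: "germ r s0"
  shows "\<exists>g\<in>Gr. \<forall>z\<in>insert r (N r). g z = s0 z"
proof -
  have "compatible w t v s" if "compatible v s w t" for v s w t
    using that by (auto simp: compatible_def)
  then obtain \<phi> where \<phi>: "\<phi> r = s0" "\<And>v. v \<in> V0 \<union> V1 \<Longrightarrow> germ v (\<phi> v)"
    "\<And>v w. (v, w) \<in> E \<Longrightarrow> compatible v (\<phi> v) w (\<phi> w)"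
    using tree_choice[where Q = germ and C = compatible, OF tree r s0 _ germ_extend] by blast
  define g where "g v = (if v \<in> V0 \<union> V1 then \<phi> v v else v)" for v
  have g1: "g z = \<phi> y z" if y: "y \<in> V1" and z: "z \<in> insert y (N y)" for y z
    using z \<phi>(3)[of y z] y nb1[OF y] by (auto simp: g_def compatible_def)
  \<comment> \<open>A vertex at distance 2 from \<open>x\<close> is compared through the vertex of
    type 1 in between, whose star carries both agreements.\<close>
  have g0: "g z = \<phi> x z" if x: "x \<in> V0" and z: "z \<in> B x" for x z
  proof -
    consider "z = x" | "(x, z) \<in> E" | y where "(x, y) \<in> E" "(y, z) \<in> E"
      using z by (auto simp: B_iff)
    then show ?thesis
    proof cases
      case 2
      then show ?thesis using \<phi>(3)[OF 2] nb0[OF x 2] by (auto simp: g_def compatible_def)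
    next
      case 3
      then show ?thesis
        using \<phi>(3)[OF 3(1)] nb0[OF x 3(1)] g1[of y z] by (auto simp: compatible_def)
    qed (simp add: g_def x)
  qed
  have N0: "z \<in> B x" if "z \<in> insert x (N x)" for x z using that by (auto simp: B_iff)
  have type0: "g x \<in> V0" if "x \<in> V0" for x
    using \<phi>(2)[of x] that by (auto simp: g_def germ_def)
  have type1: "g y \<in> V1" if "y \<in> V1" for y
    using \<phi>(2)[of y] that by (auto simp: g_def germ_def)
  have bij: "bij_betw g (N v) (N (g v))" if "v \<in> V0 \<union> V1" for v
  proof -
    have "bij_betw (\<phi> v) (N v) (N (\<phi> v v))"
    proof (cases "v \<in> V0")
      case True
      then obtain \<gamma> where "\<gamma> \<in> Gt" "\<phi> v v \<in> V0" "chart_rel v (\<phi> v) \<gamma>"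
        using \<phi>(2)[of v] by (auto simp: germ_def)
      then show ?thesis using chart_rel_bij(1)[OF True] by blast
    next
      case False
      then show ?thesis using \<phi>(2)[OF that] that by (auto simp: germ_def)
    qed
    moreover have "g z = \<phi> v z" if "z \<in> N v" for z
      using \<open>v \<in> V0 \<union> V1\<close> g1[of v z] g0[of v z] N0[of z v] that by blast
    moreover have "g v = \<phi> v v" using that by (simp add: g_def)
    ultimately show ?thesis using bij_betw_cong[of "N v" g "\<phi> v"] by simp
  qed
  have "g \<in> aut_plus V0 V1 E"
    by (rule local_aut_automorphism[OF type0 type1 _ bij]) (simp_all add: g_def)
  moreover have "local_aut E 4 d1 J g x \<in> Gt" if x: "x \<in> V0" for x
  proof -
    obtain \<gamma> where \<gamma>: "\<gamma> \<in> Gt" "chart_rel x (\<phi> x) \<gamma>"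
      using \<phi>(2)[of x] x by (auto simp: germ_def)
    have "local_aut E 4 d1 J g x c = \<gamma> c" for c
    proof (cases "c \<in> rt_verts 4 d1")
      case True
      then have c: "c \<in> J x ` B x" using bij_betw_imp_surj_on[OF J_bij[OF x]] by simp
      define z where "z = inv_into (B x) (J x) c"
      have z: "z \<in> B x" "J x z = c"
        using inv_into_into[OF c] f_inv_into_f[OF c] by (simp_all add: z_def)
      have "x \<in> B x" by (simp add: B_iff)
      have "local_aut E 4 d1 J g x c = J (g x) (g z)"
        using True by (simp add: local_aut_def perm_restrict_def z_def)
      also have "\<dots> = \<gamma> c"
        using \<gamma>(2) z g0[OF x z(1)] g0[OF x \<open>x \<in> B x\<close>] by (simp add: chart_rel_def)
      finally show ?thesis .
    next
      case False
      then show ?thesis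
        using permutes_not_in[OF rt_aut_permutes[OF Gt_aut[OF \<gamma>(1)]]]
        by (simp add: local_aut_def perm_restrict_def)
    qed
    then have "local_aut E 4 d1 J g x = \<gamma>" by blast
    with \<gamma>(1) show ?thesis by simp
  qed
  ultimately have "g \<in> Gr" by (simp add: G_group_def)
  moreover have "g z = s0 z" if "z \<in> insert r (N r)" for z
    using r that g1[of r z] g0[of r z] N0[OF that] \<phi>(1) by auto
  ultimately show ?thesis by blast
qed

lemma G_group_chart:
  assumes g: "g \<in> Gr" and x: "x \<in> V0"
  shows "local_aut E 4 d1 J g x \<in> Gt" "chart_rel x g (local_aut E 4 d1 J g x)"
proof -
  have aut: "g \<in> aut_plus V0 V1 E" using g by (simp add: G_group_def)
  show "local_aut E 4 d1 J g x \<in> Gt" using g x by (simp add: G_group_def)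
  show "chart_rel x g (local_aut E 4 d1 J g x)"
    unfolding chart_rel_def
  proof
    fix z assume z: "z \<in> B x"
    then have "g z \<in> B (g x)"
      using aut_plusD(4)[OF aut] unfolding B_iff by blast
    moreover have "local_aut E 4 d1 J g x (J x z) = J (g x) (g z)"
      using J_in[OF x z] inv_into_f_f[OF bij_betw_imp_inj_on[OF J_bij[OF x]] z]
      by (simp add: local_aut_def perm_restrict_def)
    ultimately show "g z \<in> B (g x) \<and> J (g x) (g z) = local_aut E 4 d1 J g x (J x z)" by simp
  qed
qed

lemma G_group_N:
  assumes "g \<in> Gr" "g v = v"
  shows "g ` N v \<subseteq> N v"
proof -
  have "g \<in> aut_plus V0 V1 E" using assms(1) by (simp add: G_group_def)
  from aut_plusD(4)[OF this, of v] assms(2) show ?thesis by auto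
qed

section \<open>The local actions\<close>

lemma local_action_V0:
  assumes x: "x \<in> V0"
  shows "perm_isomorphic (incident_edges E x) (local_action E Gr x) {1..4} (carrier (alt_group 4))"
proof -
  \<comment> \<open>The chart and \<open>\<alpha>\<close> assign to each neighbour a child of the
    tree with eight leaves, hence a line; in this numbering the local action is the action on lines.
    The default 0 is not a label of any neighbour.\<close>
  define lab where "lab y = (case \<alpha> (J x y) of RChild a \<Rightarrow> Suc a | _ \<Rightarrow> 0)" for y
  have "bij_betw (\<lambda>z. case z of RChild a \<Rightarrow> Suc a | _ \<Rightarrow> 0) (rt_children 4) {1..4}"
  proof -
    have "rt_children 4 = RChild ` {..<4}" by (auto simp: rt_children_def)
    moreover have "Suc ` {..<4} = {1..4}"
      by (rule image_Suc_lessThan)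
    ultimately show ?thesis by (auto simp: bij_betw_def inj_on_def image_image)
  qed
  then have "bij_betw ((\<lambda>z. case z of RChild a \<Rightarrow> Suc a | _ \<Rightarrow> 0) \<circ> (\<alpha> \<circ> J x)) (N x) {1..4}"
    by (intro bij_betw_trans[OF bij_betw_trans[OF J_bij_children[OF x] \<alpha>_bij]])
  then have lab_bij: "bij_betw lab (N x) {1..4}"
    by (simp add: comp_def lab_def[abs_def])
  have \<alpha>J: "\<exists>a. \<alpha> (J x y) = RChild a \<and> lab y = Suc a" if "y \<in> N x" for y
  proof -
    have "\<alpha> (J x y) \<in> rt_children 4"
      using bij_betwE[OF \<alpha>_bij] bij_betwE[OF J_bij_children[OF x]] that by blast
    then show ?thesis by (auto simp: rt_children_def lab_def)
  qed
  have inB: "y \<in> B x" if "y \<in> N x" for y using that by (auto simp: B_iff)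
  show ?thesis
  proof (rule perm_isomorphic_local_action[OF E_irrefl lab_bij G_group_N])
    fix k :: "nat \<Rightarrow> nat"
    show "k \<in> carrier (alt_group 4) \<longleftrightarrow> k permutes {1..4} \<and>
        (\<exists>g\<in>Gr. g x = x \<and> (\<forall>y\<in>N x. k (lab y) = lab (g y)))"
      unfolding alt_group_carrier
    proof (intro conj_cong refl iffI)
      assume k: "k permutes {1..4}" and "evenperm k"
      then obtain \<gamma> where \<gamma>: "\<gamma> \<in> Gt"
        "\<And>z a. z \<in> rt_children 4 \<Longrightarrow> \<alpha> z = RChild a \<Longrightarrow> \<alpha> (\<gamma> z) = RChild (k (Suc a) - 1)"
        using Gt_realizes_even by blast
      obtain s where s: "germ x s" "s x = x" "chart_rel x s \<gamma>"
        using germ_from_chart[OF x x \<gamma>(1)] by blast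
      obtain g where g: "g \<in> Gr" "\<And>z. z \<in> insert x (N x) \<Longrightarrow> g z = s z"
        using G_group_extend[of x s] x s(1) by blast
      have "k (lab y) = lab (g y)" if y: "y \<in> N x" for y
      proof -
        obtain a where a: "\<alpha> (J x y) = RChild a" "lab y = Suc a" using \<alpha>J[OF y] by blast
        have "J x (g y) = \<gamma> (J x y)"
          using s g(2) inB[OF y] y by (auto simp: chart_rel_def)
        then have "\<alpha> (J x (g y)) = RChild (k (Suc a) - 1)"
          using \<gamma>(2)[OF _ a(1)] bij_betwE[OF J_bij_children[OF x]] y by simp
        moreover have "k (Suc a) \<in> {1..4}"
          using bij_betwE[OF lab_bij] y a(2) permutes_in_image[OF k] by metis
        ultimately show ?thesis using a(2) by (simp add: lab_def)
      qed
      then show "\<exists>g\<in>Gr. g x = x \<and> (\<forall>y\<in>N x. k (lab y) = lab (g y))"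
        using g s(2) by (intro bexI[of _ g]) auto
    next
      assume k: "k permutes {1..4}" and "\<exists>g\<in>Gr. g x = x \<and> (\<forall>y\<in>N x. k (lab y) = lab (g y))"
      then obtain g where g: "g \<in> Gr" "g x = x" "\<And>y. y \<in> N x \<Longrightarrow> k (lab y) = lab (g y)" by blast
      show "evenperm k"
      proof (rule Gt_even[OF G_group_chart(1)[OF g(1) x] k])
        fix z a assume z: "z \<in> rt_children 4" "\<alpha> z = RChild a"
        then have "z \<in> J x ` N x" using bij_betw_imp_surj_on[OF J_bij_children[OF x]] by simp
        then obtain y where y: "y \<in> N x" "z = J x y" by blast
        have "local_aut E 4 d1 J g x z = J x (g y)"
          using G_group_chart(2)[OF g(1) x] inB[OF y(1)] y(2) g(2) by (simp add: chart_rel_def)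
        moreover have "g y \<in> N x" using G_group_N[OF g(1,2)] y(1) by blast
        ultimately show "\<alpha> (local_aut E 4 d1 J g x z) = RChild (k (Suc a) - 1)"
          using \<alpha>J[of "g y"] \<alpha>J[OF y(1)] y(2) z(2) g(3)[OF y(1)] by auto
      qed
    qed
  qed
qed

text \<open>At a vertex of type 1 every permutation of the neighbours, extended by fixing the
  centre, is a germ, and germs extend to the group. Any labelling will do, since the full symmetric
  group is invariant under relabelling.\<close>

lemma local_action_V1:
  assumes y: "y \<in> V1"
  shows "perm_isomorphic (incident_edges E y) (local_action E Gr y) {1..d1} (carrier (sym_group d1))"
proof -
  obtain lab :: "'a \<Rightarrow> nat" where lab: "bij_betw lab (N y) {1..d1}"
    using finite_same_card_bij[of "N y" "{1..d1}"] card_N(2)[OF y] by auto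
  have yN: "y \<notin> N y" using E_irrefl by simp
  show ?thesis
  proof (rule perm_isomorphic_local_action[OF E_irrefl lab G_group_N])
    fix k :: "nat \<Rightarrow> nat"
    have "\<exists>g\<in>Gr. g y = y \<and> (\<forall>z\<in>N y. k (lab z) = lab (g z))" if k: "k permutes {1..d1}"
    proof -
      define s where "s z = (if z \<in> N y then inv_into (N y) lab (k (lab z)) else z)" for z
      have "bij_betw (inv_into (N y) lab \<circ> (k \<circ> lab)) (N y) (N y)"
        by (intro bij_betw_trans[OF bij_betw_trans[OF lab permutes_imp_bij[OF k]]] bij_betw_inv_into lab)
      then have "bij_betw s (N y) (N y)"
        by (rule bij_betw_cong[THEN iffD1, rotated]) (simp add: s_def)
      moreover have "s y = y" using yN by (simp add: s_def)
      ultimately have "germ y s" using y disj by (auto simp: germ_def)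
      then obtain g where g: "g \<in> Gr" "\<And>z. z \<in> insert y (N y) \<Longrightarrow> g z = s z"
        using G_group_extend[of y s] y by blast
      have "k (lab z) = lab (g z)" if z: "z \<in> N y" for z
      proof -
        have "k (lab z) \<in> lab ` N y"
          using bij_betwE[OF lab] z permutes_in_image[OF k] bij_betw_imp_surj_on[OF lab] by blast
        then show ?thesis using g(2) z by (simp add: s_def f_inv_into_f)
      qed
      then show ?thesis using g \<open>s y = y\<close> by (intro bexI[of _ g]) auto
    qed
    then show "k \<in> carrier (sym_group d1) \<longleftrightarrow> k permutes {1..d1} \<and>
        (\<exists>g\<in>Gr. g y = y \<and> (\<forall>z\<in>N y. k (lab z) = lab (g z)))"
      unfolding sym_group_carrier by blast
  qed
qed

section \<open>Legal colorings\<close>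

lemma gsphere_N: "gsphere E v 1 = N v"
  by (rule gsphere_1[OF E_irrefl])

text \<open>Once \<open>v\<close> is sent to \<open>u\<close>, a neighbour of \<open>v\<close> must
  go to the neighbour of \<open>u\<close> with the prescribed color, which exists because a legal
  coloring uses every color around \<open>u\<close>. The choice spreads over the tree, and distinct
  colors around each vertex make the result locally injective.\<close>

lemma coloring_automorphism:
  assumes i: "legal_coloring 4 d1 V0 V1 E i" and i': "legal_coloring 4 d1 V0 V1 E i'"
    and x: "x \<in> V0" "x' \<in> V0" "i x' = i' x"
  shows "\<exists>g\<in>aut_plus V0 V1 E. g x = x' \<and> (\<forall>v\<in>V0 \<union> V1. i (g v) = i' v)"
proof -
  have col: "bij_betw i (N v) (if v \<in> V0 then {1..4} else {1..d1})"
    "bij_betw i' (N v) (if v \<in> V0 then {1..4} else {1..d1})" if "v \<in> V0 \<union> V1" for v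
    using i i' that disj by (auto simp: legal_coloring_def gsphere_N simp del: One_nat_def)
  define Q where "Q v u \<longleftrightarrow> (v \<in> V0 \<longrightarrow> u \<in> V0) \<and> (v \<in> V1 \<longrightarrow> u \<in> V1) \<and> i u = i' v" for v u
  have "\<exists>u'. Q w u' \<and> (u, u') \<in> E" if vw: "(v, w) \<in> E" and Q: "Q v u" for v w u
  proof -
    have vu: "v \<in> V0 \<and> u \<in> V0 \<and> w \<in> V1 \<or> v \<in> V1 \<and> u \<in> V1 \<and> w \<in> V0"
      using bip[OF vw] Q by (auto simp: Q_def)
    have "i' w \<in> i' ` N v" using vw by blast
    also have "i' ` N v = i ` N u"
    proof -
      have "i' ` N v = (if v \<in> V0 then {1..4} else {1..d1})" "i ` N u = (if u \<in> V0 then {1..4} else {1..d1})"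
        using bij_betw_imp_surj_on[OF col(2), of v] bij_betw_imp_surj_on[OF col(1), of u] vu by blast+
      moreover have "v \<in> V0 \<longleftrightarrow> u \<in> V0" using vu disj by blast
      ultimately show ?thesis by simp
    qed
    finally obtain u' where u': "(u, u') \<in> E" "i u' = i' w" by auto
    then show ?thesis
      using vu disj nb0[of u u'] nb1[of u u'] by (auto simp: Q_def)
  qed
  moreover have "Q x x'" using x disj by (auto simp: Q_def)
  ultimately obtain \<phi> where \<phi>: "\<phi> x = x'" "\<And>v. v \<in> V0 \<union> V1 \<Longrightarrow> Q v (\<phi> v)"
    "\<And>v w. (v, w) \<in> E \<Longrightarrow> (\<phi> v, \<phi> w) \<in> E"
    using tree_choice[where Q = Q and C = "\<lambda>v u w u'. (u, u') \<in> E" and r = x and ?s0.0 = x', OF tree] x E_sym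
    by blast
  define g where "g v = (if v \<in> V0 \<union> V1 then \<phi> v else v)" for v
  have type0: "g v \<in> V0" if "v \<in> V0" for v using \<phi>(2)[of v] that by (auto simp: g_def Q_def)
  have type1: "g v \<in> V1" if "v \<in> V1" for v using \<phi>(2)[of v] that by (auto simp: g_def Q_def)
  have ig: "i (g v) = i' v" if "v \<in> V0 \<union> V1" for v using \<phi>(2)[OF that] that by (simp add: g_def Q_def)
  have gE: "(g v, g w) \<in> E" if "(v, w) \<in> E" for v w
    using \<phi>(3)[OF that] bip[OF that] by (auto simp: g_def)
  have "g \<in> aut_plus V0 V1 E"
  proof (rule local_aut_automorphism[OF type0 type1])
    fix v assume v: "v \<in> V0 \<union> V1"
    show "bij_betw g (N v) (N (g v))"
    proof (rule bij_N_I)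
      show "inj_on g (N v)"
      proof (rule inj_onI)
        fix a b assume ab: "a \<in> N v" "b \<in> N v" "g a = g b"
        then have "a \<in> V0 \<union> V1" "b \<in> V0 \<union> V1" using bip by blast+
        then have "i' a = i' b" using ig[of a] ig[of b] ab(3) by simp
        then show "a = b"
          using inj_onD[OF bij_betw_imp_inj_on[OF col(2)[OF v]]] ab by blast
      qed
    qed (use v type0 type1 gE in auto)
  qed (simp_all add: g_def)
  moreover have "g x = x'" using \<phi>(1) x by (simp add: g_def)
  ultimately show ?thesis using ig by blast
qed

lemma no_legal_coloring:
  assumes i: "legal_coloring 4 d1 V0 V1 E i" and sub: "alt_plus V0 V1 E i \<subseteq> Gr"
  shows False
proof -
  \<comment> \<open>Evenness puts the resulting automorphism into \<open>alt_plus\<close>, the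
    trivial square makes it an involution, and a moved color contradicts
    \<open>Gt_involution\<close>.\<close>
  define p :: "nat \<Rightarrow> nat" where "p = Transposition.transpose 1 2 \<circ> Transposition.transpose 3 4"
  have p: "p permutes {1..4}"
    unfolding p_def by (intro permutes_compose permutes_swap_id) auto
  have "evenperm p"
    by (simp add: p_def evenperm_comp evenperm_swap permutation_swap_id)
  have pp: "p (p c) = c" for c
    by (auto simp: p_def Transposition.transpose_def)
  have "p 1 = 2" by (simp add: p_def Transposition.transpose_def)
  define i' where "i' v = (if v \<in> V1 then p (i v) else i v)" for v
  have i0: "i ` V0 \<subseteq> {1..d1}" "i ` V1 \<subseteq> {1..4}" "\<And>v. v \<in> V1 \<Longrightarrow> bij_betw i (N v) {1..d1}"
    "\<And>v. v \<in> V0 \<Longrightarrow> bij_betw i (N v) {1..4}"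
    using i by (simp_all add: legal_coloring_def gsphere_N del: One_nat_def)
  have "bij_betw i' (N v) {1..d1}" if "v \<in> V1" for v
    using i0(3)[OF that] by (rule bij_betw_cong[THEN iffD1, rotated])
      (use nb1[OF that] disj in \<open>auto simp: i'_def\<close>)
  moreover have "bij_betw i' (N v) {1..4}" if "v \<in> V0" for v
    using bij_betw_trans[OF i0(4)[OF that] permutes_imp_bij[OF p]] by (rule bij_betw_cong[THEN iffD1, rotated])
      (use nb0[OF that] in \<open>auto simp: i'_def\<close>)
  moreover have "i' ` V0 \<subseteq> {1..d1}" using i0(1) disj by (auto simp: i'_def)
  moreover have "i' ` V1 \<subseteq> {1..4}"
    using i0(2) permutes_in_image[OF p] unfolding i'_def by auto
  ultimately have i': "legal_coloring 4 d1 V0 V1 E i'"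
    by (simp add: legal_coloring_def gsphere_N del: One_nat_def)
  obtain x where x: "x \<in> V0" using V0_nonempty by blast
  have ix: "i x = i' x" using x disj by (auto simp: i'_def)
  obtain g where g: "g \<in> aut_plus V0 V1 E" "g x = x" "\<And>v. v \<in> V0 \<union> V1 \<Longrightarrow> i (g v) = i' v"
    using coloring_automorphism[OF i i' x x] ix by blast
  note gD = aut_plusD[OF g(1)]
  have "evenperm (local_perm E i g v)" if v: "v \<in> V0 \<union> V1" for v
  proof (cases "v \<in> V0")
    case True
    have inj: "inj_on i (gsphere E v 1)" and im: "i ` gsphere E v 1 = {1..4}"
      using i0(4)[OF True] by (simp_all only: gsphere_N bij_betw_def)
    have "local_perm E i g v = p"
    proof
      fix c show "local_perm E i g v c = p c"
      proof (cases "c \<in> i ` gsphere E v 1")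
        case c: True
        then obtain z where z: "z \<in> gsphere E v 1" "c = i z" by blast
        then have "z \<in> V1" using nb0[OF True] unfolding gsphere_N by blast
        then show ?thesis
          using local_perm_apply[OF inj z(1)] z(2) g(3)[of z] by (simp add: i'_def)
      next
        case False
        then show ?thesis using local_perm_outside[OF False] permutes_not_in[OF p] im by simp
      qed
    qed
    then show ?thesis using \<open>evenperm p\<close> by simp
  next
    case False
    then have v: "v \<in> V1" using v by blast
    have inj: "inj_on i (gsphere E v 1)"
      using i0(3)[OF v] by (simp only: gsphere_N bij_betw_def)
    have "local_perm E i g v = id"
    proof
      fix c show "local_perm E i g v c = id c"
      proof (cases "c \<in> i ` gsphere E v 1")
        case True
        then obtain z where z: "z \<in> gsphere E v 1" "c = i z" by blast
        then have "z \<in> V0" using nb1[OF v] unfolding gsphere_N by blast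
        then show ?thesis
          using local_perm_apply[OF inj z(1)] z(2) g(3)[of z] disj[of z] by (auto simp: i'_def)
      next
        case False
        then show ?thesis using local_perm_outside[OF False] by simp
      qed
    qed
    then show ?thesis by simp
  qed
  then have gG: "g \<in> Gr"
    using sub g(1) by (auto simp: alt_plus_def)
  have igg: "i (g (g v)) = i v" if "v \<in> V0 \<union> V1" for v
    using g(3)[OF that] g(3)[of "g v"] gD(1,2)[of v] that disj[of v] disj[of "g v"] pp
    by (auto simp: i'_def)
  \<comment> \<open>Walking outwards from the fixed vertex \<open>x\<close>: \<open>g (g w)\<close>
    and \<open>w\<close> are neighbours of the same vertex and have the same color, so they are
    equal.\<close>
  have gg: "g (g v) = v" if "(x, v) \<in> E\<^sup>*" for v
    using that
  proof (induction rule: rtrancl_induct)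
    case base
    show ?case using g(2) by simp
  next
    case (step v w)
    then have vw: "v \<in> V0 \<union> V1" "w \<in> V0 \<union> V1" using is_tree_edge_verts[OF tree] by blast+
    have "(v, g (g w)) \<in> E"
      using gD(4)[OF gD(4)[OF step.hyps(2)]] step.IH by simp
    moreover have "inj_on i (N v)"
      using vw(1) i0(3)[of v] i0(4)[of v] by (auto simp: bij_betw_def)
    ultimately show ?case
      using inj_onD[of i "N v" "g (g w)" w] igg[OF vw(2)] step.hyps(2) by simp
  qed
  have gg': "g (g v) = v" if "v \<in> V0 \<union> V1" for v
    using gg is_tree_connected[OF tree _ that] x by blast
  define \<gamma> where "\<gamma> = local_aut E 4 d1 J g x"
  have \<gamma>: "\<gamma> \<in> Gt" and chart: "chart_rel x g \<gamma>"
    using G_group_chart[OF gG x] by (simp_all add: \<gamma>_def)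
  have \<gamma>J: "g z \<in> B x" "\<gamma> (J x z) = J x (g z)" if "z \<in> B x" for z
    using chart that g(2) by (auto simp: chart_rel_def)
  have BV: "z \<in> V0 \<union> V1" if "z \<in> B x" for z
    using that x is_tree_edge_verts[OF tree] by (auto simp: B_iff)
  have "\<gamma> \<circ> \<gamma> = id"
  proof
    fix c show "(\<gamma> \<circ> \<gamma>) c = id c"
    proof (cases "c \<in> rt_verts 4 d1")
      case True
      then have "c \<in> J x ` B x" using bij_betw_imp_surj_on[OF J_bij[OF x]] by simp
      then obtain z where "z \<in> B x" "c = J x z" by blast
      then show ?thesis using \<gamma>J gg'[OF BV] by simp
    next
      case False
      then show ?thesis
        using permutes_not_in[OF rt_aut_permutes[OF Gt_aut[OF \<gamma>]]] by simp
    qed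
  qed
  have "(1 :: nat) \<in> i ` N x" using i0(4)[OF x] by (simp add: bij_betw_def)
  then obtain y where y: "y \<in> N x" "i y = 1" by auto
  have "J x y \<in> rt_children 4" using bij_betwE[OF J_bij_children[OF x]] y(1) by blast
  then have "\<gamma> (J x y) = J x y" using Gt_involution[OF \<gamma> \<open>\<gamma> \<circ> \<gamma> = id\<close>] by blast
  moreover have "y \<in> B x" using y(1) by (auto simp: B_iff)
  ultimately have "g y = y" using \<gamma>J[of y] J_eq_iff[OF x, of "g y" y] by simp
  moreover have "y \<in> V1" using nb0[OF x] y(1) by blast
  ultimately have "i y = p (i y)" using g(3)[of y] by (simp add: i'_def)
  then show False using y(2) \<open>p 1 = 2\<close> by simp
qed

end

theorem proposition6p3:
  fixes V0 V1 :: "'a set" and E :: "'a rel" and d1 :: nat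
    and \<psi> :: "F3_plane \<Rightarrow> rvertex"
    and j j0 :: "rvertex \<Rightarrow> nat"
    and \<alpha> :: "rvertex \<Rightarrow> rvertex"
    and J :: "'a \<Rightarrow> 'a \<Rightarrow> rvertex"
  assumes "d1 \<ge> 4"
    and "semiregular_tree 4 d1 V0 V1 E"
    and "admissible_labelling \<psi>"
    and "rt_legal_coloring 4 d1 j"
    and "rt_legal_coloring 4 3 j0"
    and "j0 RRoot = j RRoot"
    and "color_matching d1 j j0 \<alpha>"
    and "\<And>x. x \<in> V0 \<Longrightarrow> rooted_ball_iso E 4 d1 x (J x)"
  defines "G \<equiv> G_group d1 V0 V1 E \<psi> j j0 \<alpha> J"
  shows "(\<forall>x\<in>V0. perm_isomorphic (incident_edges E x) (local_action E G x)
                     {1..4} (carrier (alt_group 4))) \<and>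
         (\<forall>y\<in>V1. perm_isomorphic (incident_edges E y) (local_action E G y)
                     {1..d1} (carrier (sym_group d1))) \<and>
         \<not> (\<exists>i. legal_coloring 4 d1 V0 V1 E i \<and> alt_plus V0 V1 E i \<subseteq> G)"
proof -
  interpret tree_with_charts d1 \<psi> j j0 \<alpha> V0 V1 E J
    using assms(1-8) by unfold_locales auto
  show ?thesis
    unfolding G_def using local_action_V0 local_action_V1 no_legal_coloring by blast
qed

end
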